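(* Suppose that every finite von Neumann algebra $M$ has the following property (Ueda's peak set theorem for $M$, with $A=M$): for every singular state $\varphi$ on $M$ there is a peak projection $q \in M^{**}$ for $M$ with $\varphi(q)=1$ and with $q$ dominated by the singular part projection of $M^{**}$. Then there exist no (uncountable) measurable cardinals.
   Context: A von Neumann algebra is finite if its identity is not Murray-von Neumann equivalent to a proper subprojection of itself. $M^{**}$ is regarded as a von Neumann algebra with predual $M^*$. There is a central projection $z_n\in M^{**}$ with $M_* = \{\varphi \in M^* : \varphi = \varphi(z_n\,\cdot\,)\}$; the singular part projection is $1-z_n$, and $\varphi\in M^*$ is singular if $\varphi = \varphi((1-z_n)\,\cdot\,)$. A peak projection for $M$ is a projection $q \in M^{**}$ which is the weak* limit in $M^{**}$ of $(a^n)_n$ for some $a\in M$ with $\|a\|\le 1$. An uncountable cardinal $\kappa$ is measurable if there is a nonprincipal $\kappa$-complete ultrafilter on $\kappa$. *)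

theory Defs
  imports "HOL-Analysis.Analysis" "HOL-Algebra.Module"
begin

text \<open>
  Hilbert spaces, operator algebras and their duals are treated as structures on carrier sets, in
  the style of HOL-Algebra, so that one can quantify over all of them inside a formula.  A quantification over all Hilbert spaces \<open>H :: 'h hspace\<close> ranges over
  all those whose underlying set is a subset of the type \<open>'h\<close>; for \<open>'h = 'k \<Rightarrow> complex\<close> this covers,
  up to isomorphism, every Hilbert space with at most as many elements as \<open>'k \<Rightarrow> complex\<close>, such as
  the space of square summable functions on any subset of \<open>'k\<close>.  The record
  type of modules is reused for complex vector spaces; for a mere vector space its fields
  \<open>mult\<close> and \<open>one\<close> carry no information.
\<close>

definition complex_field :: "complex ring" where
  "complex_field = \<lparr>carrier = UNIV, mult = (*), one = 1, zero = 0, add = (+)\<rparr>"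


section \<open>Complex Hilbert spaces and bounded operators\<close>

record 'h hspace = "(complex, 'h) module" +
  hinner :: "'h \<Rightarrow> 'h \<Rightarrow> complex"

definition hnorm :: "('h, 'e) hspace_scheme \<Rightarrow> 'h \<Rightarrow> real" where
  "hnorm H x = sqrt (Re (hinner H x x))"

text \<open>The value outside the carrier is chosen so that the library locale for metric spaces applies.\<close>

definition hdist :: "('h, 'e) hspace_scheme \<Rightarrow> 'h \<Rightarrow> 'h \<Rightarrow> real" where
  "hdist H x y = (if x \<in> carrier H \<and> y \<in> carrier H then hnorm H (x \<ominus>\<^bsub>H\<^esub> y) else 0)"

definition hilbert_space :: "('h, 'e) hspace_scheme \<Rightarrow> bool" where
  "hilbert_space H \<longleftrightarrow>
     Module.module complex_field H \<and>
     (\<forall>x\<in>carrier H. \<forall>y\<in>carrier H. \<forall>z\<in>carrier H.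
        hinner H (x \<oplus>\<^bsub>H\<^esub> y) z = hinner H x z + hinner H y z) \<and>
     (\<forall>c. \<forall>x\<in>carrier H. \<forall>y\<in>carrier H. hinner H (c \<odot>\<^bsub>H\<^esub> x) y = c * hinner H x y) \<and>
     (\<forall>x\<in>carrier H. \<forall>y\<in>carrier H. hinner H y x = cnj (hinner H x y)) \<and>
     (\<forall>x\<in>carrier H. hinner H x x \<in> \<real>\<^sub>\<ge>\<^sub>0) \<and>
     (\<forall>x\<in>carrier H. hinner H x x = 0 \<longrightarrow> x = \<zero>\<^bsub>H\<^esub>) \<and>
     Metric_space.mcomplete (carrier H) (hdist H)"

definition bounded_operators :: "('h, 'e) hspace_scheme \<Rightarrow> ('h \<Rightarrow> 'h) set" where
  "bounded_operators H = {T \<in> carrier H \<rightarrow>\<^sub>E carrier H.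
     (\<forall>x\<in>carrier H. \<forall>y\<in>carrier H. T (x \<oplus>\<^bsub>H\<^esub> y) = T x \<oplus>\<^bsub>H\<^esub> T y) \<and>
     (\<forall>c. \<forall>x\<in>carrier H. T (c \<odot>\<^bsub>H\<^esub> x) = c \<odot>\<^bsub>H\<^esub> T x) \<and>
     (\<exists>C. \<forall>x\<in>carrier H. hnorm H (T x) \<le> C * hnorm H x)}"

definition op_norm :: "('h, 'e) hspace_scheme \<Rightarrow> ('h \<Rightarrow> 'h) \<Rightarrow> real" where
  "op_norm H T = (SUP x\<in>{x \<in> carrier H. hnorm H x \<le> 1}. hnorm H (T x))"

definition adjoint_op :: "('h, 'e) hspace_scheme \<Rightarrow> ('h \<Rightarrow> 'h) \<Rightarrow> ('h \<Rightarrow> 'h)" where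
  "adjoint_op H T = (THE S. S \<in> bounded_operators H \<and>
     (\<forall>x\<in>carrier H. \<forall>y\<in>carrier H. hinner H (T x) y = hinner H x (S y)))"

definition commutant :: "('h, 'e) hspace_scheme \<Rightarrow> ('h \<Rightarrow> 'h) set \<Rightarrow> ('h \<Rightarrow> 'h) set" where
  "commutant H S = {T \<in> bounded_operators H.
     \<forall>R\<in>S. compose (carrier H) T R = compose (carrier H) R T}"

definition von_neumann_algebra :: "('h, 'e) hspace_scheme \<Rightarrow> ('h \<Rightarrow> 'h) set \<Rightarrow> bool" where
  "von_neumann_algebra H M \<longleftrightarrow>
     hilbert_space H \<and> M \<subseteq> bounded_operators H \<and>
     (\<forall>T\<in>M. adjoint_op H T \<in> M) \<and> commutant H (commutant H M) = M"


section \<open>Normed spaces, duals and normed star-algebras\<close>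

record 'a nspace = "(complex, 'a) module" +
  vnorm :: "'a \<Rightarrow> real"

record 'a nstar_algebra = "'a nspace" +
  star :: "'a \<Rightarrow> 'a"

definition bounded_functionals :: "('a, 'e) nspace_scheme \<Rightarrow> ('a \<Rightarrow> complex) set" where
  "bounded_functionals V = {f \<in> extensional (carrier V).
     (\<forall>x\<in>carrier V. \<forall>y\<in>carrier V. f (x \<oplus>\<^bsub>V\<^esub> y) = f x + f y) \<and>
     (\<forall>c. \<forall>x\<in>carrier V. f (c \<odot>\<^bsub>V\<^esub> x) = c * f x) \<and>
     (\<exists>C. \<forall>x\<in>carrier V. cmod (f x) \<le> C * vnorm V x)}"

definition dual :: "('a, 'e) nspace_scheme \<Rightarrow> ('a \<Rightarrow> complex) nspace" where
  "dual V = \<lparr>carrier = bounded_functionals V,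
     mult = undefined,
     one = undefined,
     zero = (\<lambda>x\<in>carrier V. 0),
     add = (\<lambda>f g. \<lambda>x\<in>carrier V. f x + g x),
     smult = (\<lambda>c f. \<lambda>x\<in>carrier V. c * f x),
     vnorm = (\<lambda>f. SUP x\<in>{x \<in> carrier V. vnorm V x \<le> 1}. cmod (f x))\<rparr>"

definition evaluation :: "('a, 'e) nspace_scheme \<Rightarrow> 'a \<Rightarrow> ('a \<Rightarrow> complex) \<Rightarrow> complex" where
  "evaluation V a = (\<lambda>\<phi>\<in>carrier (dual V). \<phi> a)"

text \<open>
  The bidual of \<open>A\<close> with its canonical star-algebra structure extending that of \<open>A\<close>: the product
  is the (first) Arens product \<open>(X Y)(\<phi>) = X (Y\<phi>)\<close>, where \<open>(Y\<phi>)(a) = Y (\<phi>(a \<cdot>))\<close>, and the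
  involution is \<open>X\<^sup>*(\<phi>) = cnj (X (\<phi>\<^sup>*))\<close>, where \<open>\<phi>\<^sup>*(a) = cnj (\<phi>(a\<^sup>*))\<close>.  For a C*-algebra \<open>A\<close>
  this is the usual von Neumann algebra structure of the bidual with predual \<open>dual A\<close>.
\<close>

definition bidual ::
    "('a, 'e) nstar_algebra_scheme \<Rightarrow> (('a \<Rightarrow> complex) \<Rightarrow> complex) nstar_algebra" where
  "bidual A = \<lparr>carrier = carrier (dual (dual A)),
     mult = (\<lambda>X Y. \<lambda>\<phi>\<in>carrier (dual A).
               X (\<lambda>a\<in>carrier A. Y (\<lambda>b\<in>carrier A. \<phi> (a \<otimes>\<^bsub>A\<^esub> b)))),
     one = evaluation A \<one>\<^bsub>A\<^esub>,
     zero = \<zero>\<^bsub>dual (dual A)\<^esub>,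
     add = add (dual (dual A)),
     smult = smult (dual (dual A)),
     vnorm = vnorm (dual (dual A)),
     star = (\<lambda>X. \<lambda>\<phi>\<in>carrier (dual A). cnj (X (\<lambda>a\<in>carrier A. cnj (\<phi> (star A a)))))\<rparr>"

definition projection :: "('a, 'e) nstar_algebra_scheme \<Rightarrow> 'a \<Rightarrow> bool" where
  "projection A p \<longleftrightarrow> p \<in> carrier A \<and> p \<otimes>\<^bsub>A\<^esub> p = p \<and> star A p = p"

definition proj_le :: "('a, 'e) nstar_algebra_scheme \<Rightarrow> 'a \<Rightarrow> 'a \<Rightarrow> bool" where
  "proj_le A p q \<longleftrightarrow> projection A p \<and> projection A q \<and> p \<otimes>\<^bsub>A\<^esub> q = p"

definition central :: "('a, 'e) nstar_algebra_scheme \<Rightarrow> 'a \<Rightarrow> bool" where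
  "central A z \<longleftrightarrow> z \<in> carrier A \<and> (\<forall>x\<in>carrier A. z \<otimes>\<^bsub>A\<^esub> x = x \<otimes>\<^bsub>A\<^esub> z)"

definition mvn_equivalent :: "('a, 'e) nstar_algebra_scheme \<Rightarrow> 'a \<Rightarrow> 'a \<Rightarrow> bool" where
  "mvn_equivalent A p q \<longleftrightarrow>
     projection A p \<and> projection A q \<and>
     (\<exists>v\<in>carrier A. star A v \<otimes>\<^bsub>A\<^esub> v = p \<and> v \<otimes>\<^bsub>A\<^esub> star A v = q)"

definition finite_algebra :: "('a, 'e) nstar_algebra_scheme \<Rightarrow> bool" where
  "finite_algebra A \<longleftrightarrow>
     \<not> (\<exists>p. proj_le A p \<one>\<^bsub>A\<^esub> \<and> p \<noteq> \<one>\<^bsub>A\<^esub> \<and> mvn_equivalent A \<one>\<^bsub>A\<^esub> p)"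

definition state :: "('a, 'e) nstar_algebra_scheme \<Rightarrow> ('a \<Rightarrow> complex) \<Rightarrow> bool" where
  "state A \<phi> \<longleftrightarrow>
     \<phi> \<in> carrier (dual A) \<and>
     (\<forall>a\<in>carrier A. \<phi> (star A a \<otimes>\<^bsub>A\<^esub> a) \<in> \<real>\<^sub>\<ge>\<^sub>0) \<and> vnorm (dual A) \<phi> = 1"

definition peak_projection ::
    "('a, 'e) nstar_algebra_scheme \<Rightarrow> (('a \<Rightarrow> complex) \<Rightarrow> complex) \<Rightarrow> bool" where
  "peak_projection A q \<longleftrightarrow>
     projection (bidual A) q \<and>
     (\<exists>a\<in>carrier A. vnorm A a \<le> 1 \<and>
        (\<forall>\<phi>\<in>carrier (dual A). (\<lambda>n::nat. evaluation A (a [^]\<^bsub>A\<^esub> n) \<phi>) \<longlonglongrightarrow> q \<phi>))"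

text \<open>The functional \<open>\<phi>(X \<cdot>)\<close> on \<open>A\<close>, for \<open>\<phi>\<close> in the dual and \<open>X\<close> in the bidual of \<open>A\<close>.\<close>

definition translate :: "('a, 'e) nstar_algebra_scheme \<Rightarrow> ('a \<Rightarrow> complex) \<Rightarrow>
    (('a \<Rightarrow> complex) \<Rightarrow> complex) \<Rightarrow> 'a \<Rightarrow> complex" where
  "translate A \<phi> X = (\<lambda>a\<in>carrier A. (X \<otimes>\<^bsub>bidual A\<^esub> evaluation A a) \<phi>)"


section \<open>Von Neumann algebras, their preduals and the singular part projection\<close>

definition vn_alg :: "('h, 'e) hspace_scheme \<Rightarrow> ('h \<Rightarrow> 'h) set \<Rightarrow> ('h \<Rightarrow> 'h) nstar_algebra" where
  "vn_alg H M = \<lparr>carrier = M,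
     mult = compose (carrier H),
     one = (\<lambda>x\<in>carrier H. x),
     zero = (\<lambda>x\<in>carrier H. \<zero>\<^bsub>H\<^esub>),
     add = (\<lambda>S T. \<lambda>x\<in>carrier H. S x \<oplus>\<^bsub>H\<^esub> T x),
     smult = (\<lambda>c T. \<lambda>x\<in>carrier H. c \<odot>\<^bsub>H\<^esub> T x),
     vnorm = op_norm H,
     star = adjoint_op H\<rparr>"

definition square_summable :: "('h, 'e) hspace_scheme \<Rightarrow> (nat \<Rightarrow> 'h) \<Rightarrow> bool" where
  "square_summable H \<xi> \<longleftrightarrow> range \<xi> \<subseteq> carrier H \<and> summable (\<lambda>n. (hnorm H (\<xi> n))\<^sup>2)"

text \<open>
  The sigma-weak topology on \<open>M\<close>: the coarsest one for which all functionals
  \<open>T \<mapsto> (\<Sum>n. \<langle>T \<xi>\<^sub>n, \<eta>\<^sub>n\<rangle>)\<close> with square summable \<open>\<xi>\<close> and \<open>\<eta>\<close> are continuous.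
\<close>

definition sigma_weak_topology ::
    "('h, 'e) hspace_scheme \<Rightarrow> ('h \<Rightarrow> 'h) set \<Rightarrow> ('h \<Rightarrow> 'h) topology" where
  "sigma_weak_topology H M = topology_generated_by
     {{T \<in> M. (\<Sum>n. hinner H (T (\<xi> n)) (\<eta> n)) \<in> U} | \<xi> \<eta> U.
        square_summable H \<xi> \<and> square_summable H \<eta> \<and> open U}"

definition predual :: "('h, 'e) hspace_scheme \<Rightarrow> ('h \<Rightarrow> 'h) set \<Rightarrow> (('h \<Rightarrow> 'h) \<Rightarrow> complex) set" where
  "predual H M = {\<phi> \<in> carrier (dual (vn_alg H M)).
     continuous_map (sigma_weak_topology H M) euclidean \<phi>}"

definition normal_part_proj ::
    "('h, 'e) hspace_scheme \<Rightarrow> ('h \<Rightarrow> 'h) set \<Rightarrow> (('h \<Rightarrow> 'h) \<Rightarrow> complex) \<Rightarrow> complex" where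
  "normal_part_proj H M = (THE z.
     projection (bidual (vn_alg H M)) z \<and> central (bidual (vn_alg H M)) z \<and>
     predual H M = {\<phi> \<in> carrier (dual (vn_alg H M)). \<phi> = translate (vn_alg H M) \<phi> z})"

definition singular_part_proj ::
    "('h, 'e) hspace_scheme \<Rightarrow> ('h \<Rightarrow> 'h) set \<Rightarrow> (('h \<Rightarrow> 'h) \<Rightarrow> complex) \<Rightarrow> complex" where
  "singular_part_proj H M =
     \<one>\<^bsub>bidual (vn_alg H M)\<^esub> \<ominus>\<^bsub>bidual (vn_alg H M)\<^esub> normal_part_proj H M"

definition singular_functional ::
    "('h, 'e) hspace_scheme \<Rightarrow> ('h \<Rightarrow> 'h) set \<Rightarrow> (('h \<Rightarrow> 'h) \<Rightarrow> complex) \<Rightarrow> bool" where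
  "singular_functional H M \<phi> \<longleftrightarrow>
     \<phi> \<in> carrier (dual (vn_alg H M)) \<and>
     \<phi> = translate (vn_alg H M) \<phi> (singular_part_proj H M)"

definition ueda_peak_set_property :: "('h, 'e) hspace_scheme \<Rightarrow> ('h \<Rightarrow> 'h) set \<Rightarrow> bool" where
  "ueda_peak_set_property H M \<longleftrightarrow>
     (\<forall>\<phi>. state (vn_alg H M) \<phi> \<and> singular_functional H M \<phi> \<longrightarrow>
        (\<exists>q. peak_projection (vn_alg H M) q \<and> q \<phi> = 1 \<and>
             proj_le (bidual (vn_alg H M)) q (singular_part_proj H M)))"


section \<open>Measurable cardinals\<close>

unbundle cardinal_syntax

definition ultrafilter_on :: "'k set \<Rightarrow> 'k set set \<Rightarrow> bool" where
  "ultrafilter_on K U \<longleftrightarrow>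
     U \<subseteq> Pow K \<and> K \<in> U \<and> {} \<notin> U \<and>
     (\<forall>A\<in>U. \<forall>B\<in>U. A \<inter> B \<in> U) \<and>
     (\<forall>A\<in>U. \<forall>B. A \<subseteq> B \<and> B \<subseteq> K \<longrightarrow> B \<in> U) \<and>
     (\<forall>A. A \<subseteq> K \<longrightarrow> A \<in> U \<or> K - A \<in> U)"

definition nonprincipal_on :: "'k set \<Rightarrow> 'k set set \<Rightarrow> bool" where
  "nonprincipal_on K U \<longleftrightarrow> \<not> (\<exists>x\<in>K. U = {A. A \<subseteq> K \<and> x \<in> A})"

text \<open>
  Cardinals are represented, as in the library, by cardinal orders \<open>\<kappa>\<close> (well-orders of minimal
  type on their field); the underlying set of \<open>\<kappa>\<close> is \<open>Field \<kappa>\<close>.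
\<close>

definition complete_ultrafilter :: "'k rel \<Rightarrow> 'k set set \<Rightarrow> bool" where
  "complete_ultrafilter \<kappa> U \<longleftrightarrow>
     ultrafilter_on (Field \<kappa>) U \<and>
     (\<forall>\<A>. \<A> \<subseteq> U \<and> \<A> \<noteq> {} \<and> |\<A>| <o \<kappa> \<longrightarrow> \<Inter>\<A> \<in> U)"

definition measurable_cardinal :: "'k rel \<Rightarrow> bool" where
  "measurable_cardinal \<kappa> \<longleftrightarrow>
     Card_order \<kappa> \<and> natLeq <o \<kappa> \<and>
     (\<exists>U. complete_ultrafilter \<kappa> U \<and> nonprincipal_on (Field \<kappa>) U)"

end

theory Submission
  imports Defs
begin

text \<open>
  A measurable cardinal \<open>\<kappa> :: 'k rel\<close> yields a nonprincipal countably complete ultrafilter on the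
  type \<open>'k\<close>.  Take for \<open>M\<close> the algebra of bounded functions on \<open>'k\<close>, acting by multiplication on
  the square summable functions; it is commutative, hence finite.  Its normal functionals are the
  \<open>g \<mapsto> (\<Sum>\<^sub>\<infinity>x. g x * w x)\<close> with \<open>w\<close> absolutely summable, so the projection onto the normal part
  sends \<open>\<phi>\<close> to the sum of its values on the atoms, and the limit \<open>\<phi>\<close> along the ultrafilter is a
  singular state.  By countable completeness, every \<open>a\<close> in \<open>M\<close> takes the value \<open>\<phi> a\<close> at some point
  \<open>x\<close>; as \<open>\<phi>\<close> and the evaluation at \<open>x\<close> then agree on all powers of \<open>a\<close>, a peak projection
  \<open>q = lim a^n\<close> with \<open>q \<phi> = 1\<close> is also \<open>1\<close> at the evaluation at \<open>x\<close>.  That evaluation is normal, so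
  \<open>q\<close> is not dominated by the singular part projection.
\<close>

section \<open>The Hilbert space of square summable functions\<close>

text \<open>Most of the work goes into the definite description behind
  \<open>normal_part_proj\<close>: \<open>atomic_proj\<close> has to be a central projection of the
  Arens bidual whose fixed functionals are exactly the sigma-weakly continuous ones, and it has to
  be the only such element. Centrality is the analytic point. One of the two products sums an
  element \<open>X\<close> of the bidual over the atoms, the other applies \<open>X\<close> to the
  infinite sum, and only norm continuity of \<open>X\<close> identifies them. Uniqueness is algebra:
  the bidual acts on the dual through \<open>translate\<close>, and this action respects products.

  The point \<open>x\<close> is what countable completeness buys. Any free ultrafilter gives a
  singular character, but its value at \<open>a\<close> need not be attained: 1/n tends to 0 along
  every free ultrafilter on the positive integers. Since the complex plane has a countable basis,
  countable completeness makes every function constant on a large set, so that the limit is an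
  actual value. Measurability provides this closure under countable intersections because
  \<open>\<kappa>\<close> is uncountable.\<close>

definition ell2 :: "('k \<Rightarrow> complex) hspace" where
  "ell2 = \<lparr>carrier = {f. (\<lambda>x. (cmod (f x))\<^sup>2) summable_on UNIV},
     mult = undefined,
     one = undefined,
     zero = (\<lambda>x. 0),
     add = (\<lambda>f g x. f x + g x),
     smult = (\<lambda>c f x. c * f x),
     hinner = (\<lambda>f g. \<Sum>\<^sub>\<infinity>x. f x * cnj (g x))\<rparr>"

lemma ell2_simps [simp]:
  "zero ell2 = (\<lambda>x. 0)" "add ell2 f g = (\<lambda>x. f x + g x)" "smult ell2 c f = (\<lambda>x. c * f x)"
  "hinner ell2 f g = (\<Sum>\<^sub>\<infinity>x. f x * cnj (g x))"
  by (simp_all add: ell2_def)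

lemma in_ell2_iff: "f \<in> carrier ell2 \<longleftrightarrow> (\<lambda>x. (cmod (f x))\<^sup>2) summable_on UNIV"
  by (simp add: ell2_def)

lemma summable_on_le:
  fixes f g :: "'a \<Rightarrow> real"
  assumes "g summable_on A" "\<And>x. x \<in> A \<Longrightarrow> 0 \<le> f x" "\<And>x. x \<in> A \<Longrightarrow> f x \<le> g x"
  shows "f summable_on A"
  using assms summable_on_comparison_test by blast

lemma cmod_add_sq_le: "(cmod (a + b))\<^sup>2 \<le> 2 * (cmod a)\<^sup>2 + 2 * (cmod b)\<^sup>2"
proof -
  have "(cmod (a + b))\<^sup>2 \<le> (cmod a + cmod b)\<^sup>2"
    by (simp add: norm_triangle_ineq power_mono)
  also have "\<dots> \<le> 2 * (cmod a)\<^sup>2 + 2 * (cmod b)\<^sup>2"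
    using zero_le_power2[of "cmod a - cmod b"] by (simp add: power2_eq_square algebra_simps)
  finally show ?thesis .
qed

lemma ell2_add_closed:
  assumes "f \<in> carrier ell2" "g \<in> carrier ell2"
  shows "(\<lambda>x. f x + g x) \<in> carrier ell2"
proof -
  have "(\<lambda>x. 2 * (cmod (f x))\<^sup>2 + 2 * (cmod (g x))\<^sup>2) summable_on UNIV"
    using assms by (intro summable_on_add summable_on_cmult_right) (auto simp: in_ell2_iff)
  then show ?thesis
    unfolding in_ell2_iff by (rule summable_on_le) (auto simp: cmod_add_sq_le)
qed

lemma ell2_mult_closed:
  assumes "f \<in> carrier ell2" "\<And>x. cmod (g x) \<le> K"
  shows "(\<lambda>x. g x * f x) \<in> carrier ell2"
proof -
  have "(\<lambda>x. K\<^sup>2 * (cmod (f x))\<^sup>2) summable_on UNIV"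
    using assms by (intro summable_on_cmult_right) (auto simp: in_ell2_iff)
  then show ?thesis
    unfolding in_ell2_iff
    by (rule summable_on_le)
      (auto simp: norm_mult power_mult_distrib intro!: mult_right_mono power_mono assms)
qed

lemma ell2_smult_closed: "f \<in> carrier ell2 \<Longrightarrow> (\<lambda>x. c * f x) \<in> carrier ell2"
  by (rule ell2_mult_closed[where K = "cmod c"]) auto

lemma ell2_uminus_closed: "f \<in> carrier ell2 \<Longrightarrow> (\<lambda>x. - f x) \<in> carrier ell2"
  by (simp add: in_ell2_iff)

lemma ell2_diff_closed:
  "f \<in> carrier ell2 \<Longrightarrow> g \<in> carrier ell2 \<Longrightarrow> (\<lambda>x. f x - g x) \<in> carrier ell2"
  using ell2_add_closed[of f "\<lambda>x. - g x"] ell2_uminus_closed[of g] by simp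

lemma ell2_zero_closed: "(\<lambda>x. 0) \<in> carrier ell2"
  by (simp add: in_ell2_iff)

text \<open>A crude form of the inequality of arithmetic and geometric means. It takes the place of
  Cauchy-Schwarz wherever summability of a product, not a sharp bound, is wanted.\<close>

lemma mult_le_sum_sq: "(a::real) * b \<le> a\<^sup>2 + b\<^sup>2"
  using zero_le_power2[of "a - b"] zero_le_power2[of a] zero_le_power2[of b]
  unfolding power2_diff by linarith

lemma ell2_prod_abs_summable:
  assumes "f \<in> carrier ell2" "g \<in> carrier ell2"
  shows "(\<lambda>x. cmod (f x * cnj (g x))) summable_on UNIV"
proof -
  have "(\<lambda>x. (cmod (f x))\<^sup>2 + (cmod (g x))\<^sup>2) summable_on UNIV"
    using assms by (intro summable_on_add) (auto simp: in_ell2_iff)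
  then show ?thesis
    by (rule summable_on_le) (auto simp: norm_mult mult_le_sum_sq)
qed

lemma ell2_prod_summable:
  "f \<in> carrier ell2 \<Longrightarrow> g \<in> carrier ell2 \<Longrightarrow> (\<lambda>x. f x * cnj (g x)) summable_on UNIV"
  by (rule abs_summable_summable[OF ell2_prod_abs_summable])

text \<open>Holds for every \<open>f\<close>: if the squares are not summable, both infinite sums
  are 0 by convention. The formula for \<open>hnorm ell2\<close> inherits this generality.\<close>

lemma hinner_self: "(\<Sum>\<^sub>\<infinity>x. f x * cnj (f x)) = complex_of_real (\<Sum>\<^sub>\<infinity>x. (cmod (f x))\<^sup>2)"
proof -
  have "complex_of_real (\<Sum>\<^sub>\<infinity>x. (cmod (f x))\<^sup>2) = (\<Sum>\<^sub>\<infinity>x. complex_of_real ((cmod (f x))\<^sup>2))"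
    by (rule infsum_bounded_linear_strong[OF _ bounded_linear_of_real, symmetric])
      (auto simp del: of_real_power intro: summable_on_of_real dest: summable_on_Re)
  then show ?thesis
    by (simp only: complex_norm_square)
qed

lemma hnorm_ell2: "hnorm ell2 f = sqrt (\<Sum>\<^sub>\<infinity>x. (cmod (f x))\<^sup>2)"
  by (simp add: hnorm_def hinner_self)

lemma hnorm_ell2_nonneg: "0 \<le> hnorm ell2 f"
  by (simp add: hnorm_ell2 infsum_nonneg)

lemma hnorm_ell2_sq: "(hnorm ell2 f)\<^sup>2 = (\<Sum>\<^sub>\<infinity>x. (cmod (f x))\<^sup>2)"
  by (simp add: hnorm_ell2 infsum_nonneg)

lemma hnorm_ell2_tendsto:
  assumes "f \<in> carrier ell2"
  shows "((\<lambda>F. L2_set (\<lambda>x. cmod (f x)) F) \<longlongrightarrow> hnorm ell2 f) (finite_subsets_at_top UNIV)"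
  using infsum_tendsto[OF assms[unfolded in_ell2_iff]] unfolding L2_set_def hnorm_ell2
  by (rule tendsto_real_sqrt)

lemma L2_set_le_hnorm:
  assumes "f \<in> carrier ell2" "finite F"
  shows "L2_set (\<lambda>x. cmod (f x)) F \<le> hnorm ell2 f"
  unfolding L2_set_def hnorm_ell2
  using assms by (auto intro!: real_sqrt_le_mono finite_sum_le_infsum simp: in_ell2_iff)

lemma cmod_le_hnorm:
  assumes "f \<in> carrier ell2"
  shows "cmod (f x) \<le> hnorm ell2 f"
  using L2_set_le_hnorm[OF assms, of "{x}"] by (simp add: L2_set_def)

text \<open>The norm is the limit of \<open>L2_set\<close> over finite sets, so a bound uniform in
  the finite set survives in the limit. The triangle inequality, the estimate for multipliers and
  completeness are reduced to finite sums in this way.\<close>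

lemma L2_set_bound:
  assumes "\<And>F. finite F \<Longrightarrow> L2_set (\<lambda>x. cmod (f x)) F \<le> K"
  shows "f \<in> carrier ell2" "hnorm ell2 f \<le> K"
proof -
  have "0 \<le> K"
    using assms[of "{}"] by simp
  have "(\<Sum>x\<in>F. (cmod (f x))\<^sup>2) \<le> K\<^sup>2" if "finite F" for F
    using assms[OF that] unfolding L2_set_def by (metis \<open>0 \<le> K\<close> real_sqrt_le_iff real_sqrt_abs abs_of_nonneg)
  then show f: "f \<in> carrier ell2"
    unfolding in_ell2_iff
    by (intro nonneg_bdd_above_summable_on) (auto intro!: bdd_aboveI)
  show "hnorm ell2 f \<le> K"
    by (rule tendsto_upperbound[OF hnorm_ell2_tendsto[OF f]])
      (auto intro!: assms eventually_finite_subsets_at_top_weakI)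
qed

lemma hnorm_mult_le:
  assumes "f \<in> carrier ell2" "\<And>x. cmod (g x) \<le> K"
  shows "hnorm ell2 (\<lambda>x. g x * f x) \<le> K * hnorm ell2 f"
proof (rule L2_set_bound(2))
  fix F :: "'a set" assume "finite F"
  have "0 \<le> K" using assms(2) norm_ge_zero order_trans by blast
  have "L2_set (\<lambda>x. cmod (g x * f x)) F \<le> L2_set (\<lambda>x. K * cmod (f x)) F"
    by (rule L2_set_mono) (auto simp: norm_mult intro!: mult_right_mono assms)
  also have "\<dots> = K * L2_set (\<lambda>x. cmod (f x)) F"
    using \<open>0 \<le> K\<close> by (simp add: L2_set_right_distrib)
  also have "\<dots> \<le> K * hnorm ell2 f"
    using \<open>0 \<le> K\<close> \<open>finite F\<close> assms by (intro mult_left_mono L2_set_le_hnorm) auto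
  finally show "L2_set (\<lambda>x. cmod (g x * f x)) F \<le> K * hnorm ell2 f" .
qed

lemma hnorm_triangle:
  assumes "f \<in> carrier ell2" "g \<in> carrier ell2"
  shows "hnorm ell2 (\<lambda>x. f x + g x) \<le> hnorm ell2 f + hnorm ell2 g"
proof (rule L2_set_bound(2))
  fix F :: "'a set" assume "finite F"
  have "L2_set (\<lambda>x. cmod (f x + g x)) F \<le> L2_set (\<lambda>x. cmod (f x) + cmod (g x)) F"
    by (rule L2_set_mono) (auto simp: norm_triangle_ineq)
  also have "\<dots> \<le> L2_set (\<lambda>x. cmod (f x)) F + L2_set (\<lambda>x. cmod (g x)) F"
    by (rule L2_set_triangle_ineq)
  also have "\<dots> \<le> hnorm ell2 f + hnorm ell2 g"
    using \<open>finite F\<close> assms by (intro add_mono L2_set_le_hnorm) auto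
  finally show "L2_set (\<lambda>x. cmod (f x + g x)) F \<le> hnorm ell2 f + hnorm ell2 g" .
qed

lemma abelian_group_ell2: "abelian_group (ell2 :: ('k \<Rightarrow> complex) hspace)"
proof (rule abelian_groupI)
  fix f :: "'k \<Rightarrow> complex" assume "f \<in> carrier ell2"
  then show "\<exists>y\<in>carrier ell2. y \<oplus>\<^bsub>ell2\<^esub> f = \<zero>\<^bsub>ell2\<^esub>"
    by (intro bexI[of _ "\<lambda>x. - f x"]) (auto simp: ell2_uminus_closed)
qed (auto simp: ell2_add_closed ell2_zero_closed)

lemma ell2_minus:
  assumes "f \<in> carrier ell2" "g \<in> carrier ell2"
  shows "f \<ominus>\<^bsub>ell2\<^esub> g = (\<lambda>x. f x - g x)"
proof -
  have "\<ominus>\<^bsub>ell2\<^esub> g = (\<lambda>x. - g x)"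
    by (rule abelian_group.minus_equality[OF abelian_group_ell2])
      (auto simp: assms ell2_uminus_closed)
  then show ?thesis by (simp add: a_minus_def)
qed

lemma cring_complex_field: "cring complex_field"
proof (rule cringI)
  show "abelian_group complex_field"
  proof (rule abelian_groupI)
    fix x assume "x \<in> carrier complex_field"
    then show "\<exists>y\<in>carrier complex_field. y \<oplus>\<^bsub>complex_field\<^esub> x = \<zero>\<^bsub>complex_field\<^esub>"
      by (intro bexI[of _ "- x"]) (auto simp: complex_field_def)
  qed (auto simp: complex_field_def)
  show "comm_monoid complex_field"
    by (rule comm_monoidI) (auto simp: complex_field_def)
qed (auto simp: complex_field_def algebra_simps)

lemma module_ell2: "Module.module complex_field ell2"
  by (rule moduleI[OF cring_complex_field abelian_group_ell2])
    (auto simp: complex_field_def ell2_smult_closed algebra_simps)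

lemma hdist_ell2:
  "hdist ell2 f g = (if f \<in> carrier ell2 \<and> g \<in> carrier ell2 then hnorm ell2 (\<lambda>x. f x - g x) else 0)"
  by (simp add: hdist_def ell2_minus)

lemma hnorm_minus_commute: "hnorm ell2 (\<lambda>x. f x - g x) = hnorm ell2 (\<lambda>x. g x - f x)"
  by (simp add: hnorm_ell2 norm_minus_commute)

lemma Metric_space_ell2: "Metric_space (carrier ell2) (hdist ell2)"
proof
  fix f g h :: "'k \<Rightarrow> complex"
  show "0 \<le> hdist ell2 f g"
    by (simp add: hdist_ell2 hnorm_ell2_nonneg)
  show "hdist ell2 f g = hdist ell2 g f"
    by (auto simp: hdist_ell2 hnorm_minus_commute[of f g])
  assume f: "f \<in> carrier ell2" and g: "g \<in> carrier ell2"
  show "hdist ell2 f g = 0 \<longleftrightarrow> f = g"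
  proof
    assume "hdist ell2 f g = 0"
    then have "cmod (f x - g x) \<le> 0" for x
      using cmod_le_hnorm[OF ell2_diff_closed[OF f g], of x] f g by (simp add: hdist_ell2)
    then show "f = g" by auto
  qed (simp add: hdist_ell2 hnorm_ell2)
  assume h: "h \<in> carrier ell2"
  show "hdist ell2 f h \<le> hdist ell2 f g + hdist ell2 g h"
    using hnorm_triangle[OF ell2_diff_closed[OF f g] ell2_diff_closed[OF g h]]
    by (simp add: hdist_ell2 f g h)
qed

lemma mcomplete_ell2: "Metric_space.mcomplete (carrier ell2) (hdist (ell2 :: ('k \<Rightarrow> complex) hspace))"
proof -
  interpret Metric_space "carrier ell2" "hdist (ell2 :: ('k \<Rightarrow> complex) hspace)"
    by (rule Metric_space_ell2)
  show ?thesis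
    unfolding mcomplete_def
  proof (intro allI impI)
    fix \<sigma> :: "nat \<Rightarrow> 'k \<Rightarrow> complex"
    assume \<sigma>: "MCauchy \<sigma>"
    have \<sigma>_in: "\<sigma> n \<in> carrier ell2" for n
      using \<sigma> by (auto simp: MCauchy_def)
    have cau: "\<exists>N. \<forall>n\<ge>N. \<forall>m\<ge>N. hnorm ell2 (\<lambda>x. \<sigma> n x - \<sigma> m x) < \<epsilon>" if "\<epsilon> > 0" for \<epsilon>
      using \<sigma> that unfolding MCauchy_def by (simp add: hdist_ell2 \<sigma>_in)
    have "Cauchy (\<lambda>n. \<sigma> n x)" for x
      unfolding Cauchy_def dist_norm
      using cau cmod_le_hnorm[OF ell2_diff_closed[OF \<sigma>_in \<sigma>_in], of _ x]
      by (meson le_less_trans)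
    then have "\<exists>l. (\<lambda>n. \<sigma> n x) \<longlonglongrightarrow> l" for x
      by (simp add: Cauchy_convergent_iff convergent_def)
    then obtain f where f: "\<And>x. (\<lambda>n. \<sigma> n x) \<longlonglongrightarrow> f x" by metis
    have lim: "\<exists>N. \<forall>n\<ge>N. (\<lambda>x. \<sigma> n x - f x) \<in> carrier ell2 \<and> hnorm ell2 (\<lambda>x. \<sigma> n x - f x) \<le> \<epsilon>"
      if "\<epsilon> > 0" for \<epsilon>
    proof -
      obtain N where N: "\<And>n m. n \<ge> N \<Longrightarrow> m \<ge> N \<Longrightarrow> hnorm ell2 (\<lambda>x. \<sigma> n x - \<sigma> m x) < \<epsilon>"
        using cau[OF \<open>\<epsilon> > 0\<close>] by blast
      \<comment> \<open>Keep \<open>n\<close> and the finite set fixed and let \<open>m\<close> tend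
        to infinity in the Cauchy estimate; \<open>L2_set_bound\<close> then removes the finite set.
        The pointwise limit alone would give no control of the norm.\<close>
      have *: "L2_set (\<lambda>x. cmod (\<sigma> n x - f x)) F \<le> \<epsilon>" if "n \<ge> N" "finite F" for n F
      proof (rule tendsto_upperbound)
        show "(\<lambda>m. L2_set (\<lambda>x. cmod (\<sigma> n x - \<sigma> m x)) F) \<longlonglongrightarrow> L2_set (\<lambda>x. cmod (\<sigma> n x - f x)) F"
          unfolding L2_set_def by (intro tendsto_intros f)
        show "\<forall>\<^sub>F m in sequentially. L2_set (\<lambda>x. cmod (\<sigma> n x - \<sigma> m x)) F \<le> \<epsilon>"
          using eventually_ge_at_top[of N]
        proof eventually_elim
          case (elim m)
          then show ?case
            using L2_set_le_hnorm[OF ell2_diff_closed[OF \<sigma>_in \<sigma>_in] \<open>finite F\<close>, of n m]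
              N[OF \<open>n \<ge> N\<close> elim] by linarith
        qed
      qed auto
      show ?thesis
        using L2_set_bound[OF *] by blast
    qed
    obtain N where "(\<lambda>x. \<sigma> N x - f x) \<in> carrier ell2"
      using lim[of 1] by auto
    from ell2_diff_closed[OF \<sigma>_in[of N] this] have f_in: "f \<in> carrier ell2" by simp
    have "limitin mtopology \<sigma> f sequentially"
      unfolding limitin_metric
    proof (intro conjI f_in allI impI)
      fix \<epsilon> :: real assume "\<epsilon> > 0"
      \<comment> \<open>\<open>lim\<close> yields a weak inequality; half of
        \<open>\<epsilon>\<close> makes it strict.\<close>
      then obtain N where "\<forall>n\<ge>N. hnorm ell2 (\<lambda>x. \<sigma> n x - f x) \<le> \<epsilon> / 2"
        using lim[of "\<epsilon> / 2"] by auto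
      then show "\<forall>\<^sub>F n in sequentially. \<sigma> n \<in> carrier ell2 \<and> hdist ell2 (\<sigma> n) f < \<epsilon>"
        unfolding eventually_sequentially using \<open>\<epsilon> > 0\<close>
        by (intro exI[of _ N]) (force simp: hdist_ell2 \<sigma>_in f_in)
    qed
    then show "\<exists>x. limitin mtopology \<sigma> x sequentially" by blast
  qed
qed

lemma hilbert_space_ell2: "hilbert_space ell2"
  unfolding hilbert_space_def
proof (intro conjI ballI allI impI module_ell2 mcomplete_ell2)
  fix f g h :: "'k \<Rightarrow> complex" and c
  assume f: "f \<in> carrier ell2"
  show "hinner ell2 f f \<in> \<real>\<^sub>\<ge>\<^sub>0"
    by (simp add: hinner_self infsum_nonneg)
  show "f = \<zero>\<^bsub>ell2\<^esub>" if "hinner ell2 f f = 0"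
  proof -
    have "hnorm ell2 f = 0"
      using that by (simp add: hnorm_def)
    then show ?thesis
      using cmod_le_hnorm[OF f] by auto
  qed
  assume g: "g \<in> carrier ell2"
  show "hinner ell2 (c \<odot>\<^bsub>ell2\<^esub> f) g = c * hinner ell2 f g"
    by (simp add: mult.assoc infsum_cmult_right')
  show "hinner ell2 g f = cnj (hinner ell2 f g)"
    by (simp flip: infsum_cnj add: mult.commute)
  assume h: "h \<in> carrier ell2"
  show "hinner ell2 (f \<oplus>\<^bsub>ell2\<^esub> g) h = hinner ell2 f h + hinner ell2 g h"
    by (simp add: distrib_right infsum_add ell2_prod_summable f g h)
qed

section \<open>Multiplication operators\<close>

definition point :: "'k \<Rightarrow> 'k \<Rightarrow> complex" where
  "point x = (\<lambda>y. if y = x then 1 else 0)"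

definition mult_op :: "('k \<Rightarrow> complex) \<Rightarrow> ('k \<Rightarrow> complex) \<Rightarrow> ('k \<Rightarrow> complex)" where
  "mult_op g = (\<lambda>f\<in>carrier ell2. \<lambda>x. g x * f x)"

definition linf :: "(('k \<Rightarrow> complex) \<Rightarrow> ('k \<Rightarrow> complex)) set" where
  "linf = {mult_op g | g. bounded (range g)}"

text \<open>The diagonal matrix entry of \<open>T\<close> at \<open>x\<close>. It makes sense for
  every \<open>T\<close>, inverts \<open>mult_op\<close>, and so lets functionals on
  \<open>linf\<close> be written as functionals of functions; in \<open>commutant_linf\<close> it
  produces the multiplier.\<close>

definition symbol :: "(('k \<Rightarrow> complex) \<Rightarrow> ('k \<Rightarrow> complex)) \<Rightarrow> 'k \<Rightarrow> complex" where
  "symbol T x = T (point x) x"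

lemma bounded_range_iff: "bounded (range g) \<longleftrightarrow> (\<exists>K. \<forall>x. cmod (g x) \<le> K)"
  by (simp add: bounded_iff)

lemma bounded_rangeE:
  assumes "bounded (range g)"
  obtains K where "K \<ge> 0" "\<And>x. cmod (g x) \<le> K"
  using assms unfolding bounded_range_iff by (meson norm_ge_zero order_trans)

lemma bounded_range_intros [simp]:
  fixes g h :: "'k \<Rightarrow> complex" and c :: complex
  shows "bounded (range (point x))" "bounded (range (\<lambda>x::'k. c))"
    "bounded (range g) \<Longrightarrow> bounded (range h) \<Longrightarrow> bounded (range (\<lambda>x. g x + h x))"
    "bounded (range g) \<Longrightarrow> bounded (range h) \<Longrightarrow> bounded (range (\<lambda>x. g x * h x))"
    "bounded (range g) \<Longrightarrow> bounded (range (\<lambda>x. cnj (g x)))"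
proof -
  show "bounded (range (point x))"
    unfolding bounded_range_iff by (rule exI[of _ 1]) (simp add: point_def)
  show "bounded (range (\<lambda>x::'k. c))"
    unfolding bounded_range_iff by (rule exI[of _ "cmod c"]) simp
  show "bounded (range g) \<Longrightarrow> bounded (range (\<lambda>x. cnj (g x)))"
    unfolding bounded_range_iff by simp
  assume g: "bounded (range g)" and h: "bounded (range h)"
  obtain K where K: "K \<ge> 0" "\<And>x. cmod (g x) \<le> K" using bounded_rangeE[OF g] by blast
  obtain L where L: "L \<ge> 0" "\<And>x. cmod (h x) \<le> L" using bounded_rangeE[OF h] by blast
  have "cmod (g x + h x) \<le> K + L" for x
    using norm_triangle_ineq[of "g x" "h x"] K(2)[of x] L(2)[of x] by linarith
  then show "bounded (range (\<lambda>x. g x + h x))" unfolding bounded_range_iff by blast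
  have "cmod (g x * h x) \<le> K * L" for x
    unfolding norm_mult using K L by (intro mult_mono) auto
  then show "bounded (range (\<lambda>x. g x * h x))" unfolding bounded_range_iff by blast
qed

lemma bounded_range_sum [simp]:
  fixes g :: "'i \<Rightarrow> 'k \<Rightarrow> complex"
  assumes "\<And>i. i \<in> F \<Longrightarrow> bounded (range (g i))"
  shows "bounded (range (\<lambda>x. \<Sum>i\<in>F. g i x))"
  using assms by (induction F rule: infinite_finite_induct) auto

lemma infsum_point_mult: "(\<Sum>\<^sub>\<infinity>y. point x y * F y) = (F x :: complex)"
proof -
  have "(\<Sum>\<^sub>\<infinity>y. point x y * F y) = (\<Sum>\<^sub>\<infinity>y\<in>{x}. point x y * F y)"
    by (rule infsum_cong_neutral) (auto simp: point_def)
  then show ?thesis by (simp add: point_def)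
qed

lemma point_in_ell2: "point x \<in> carrier ell2"
  unfolding in_ell2_iff
  by (rule finite_nonzero_values_imp_summable_on) (auto simp: point_def intro: finite_subset[of _ "{x}"])

lemma hnorm_point: "hnorm ell2 (point x) = 1"
  unfolding hnorm_def by (simp add: infsum_point_mult) (simp add: point_def)

lemma hinner_point: "hinner ell2 (point x) f = cnj (f x)"
  by (simp add: infsum_point_mult)

lemma mult_op_apply: "f \<in> carrier ell2 \<Longrightarrow> mult_op g f = (\<lambda>x. g x * f x)"
  by (simp add: mult_op_def)

lemma symbol_mult_op [simp]: "symbol (mult_op g) = g"
  by (rule ext) (simp add: symbol_def mult_op_apply point_in_ell2, simp add: point_def)

lemma mult_op_eq_iff [simp]: "mult_op g = mult_op h \<longleftrightarrow> g = h"
  by (metis symbol_mult_op)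

lemma mult_op_in_linf [simp]: "mult_op g \<in> linf \<longleftrightarrow> bounded (range g)"
  by (auto simp: linf_def)

lemma linfE:
  assumes "T \<in> linf"
  obtains g where "bounded (range g)" "T = mult_op g"
  using assms unfolding linf_def by blast

lemma mult_op_closed:
  assumes "bounded (range g)" "f \<in> carrier ell2"
  shows "mult_op g f \<in> carrier ell2"
proof -
  obtain K where "\<And>x. cmod (g x) \<le> K" using assms(1) bounded_rangeE by blast
  from ell2_mult_closed[OF assms(2) this] show ?thesis
    by (simp add: mult_op_apply assms(2))
qed

lemma mult_op_bounded:
  assumes "bounded (range g)"
  shows "mult_op g \<in> bounded_operators ell2"
proof -
  obtain K where "\<And>x. cmod (g x) \<le> K" using assms bounded_rangeE by blast
  then have "\<exists>C. \<forall>f\<in>carrier ell2. hnorm ell2 (mult_op g f) \<le> C * hnorm ell2 f"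
    by (auto simp: mult_op_apply intro!: exI[of _ K] hnorm_mult_le)
  moreover have "mult_op g \<in> extensional (carrier ell2)"
    by (simp add: mult_op_def)
  ultimately show ?thesis
    using mult_op_closed[OF assms]
    by (auto simp: bounded_operators_def PiE_iff mult_op_apply ell2_add_closed ell2_smult_closed
        algebra_simps)
qed

lemma op_norm_mult_op_le:
  assumes "\<And>x. cmod (g x) \<le> K"
  shows "op_norm ell2 (mult_op (g :: 'k \<Rightarrow> complex)) \<le> K"
  unfolding op_norm_def
proof (rule cSUP_least)
  show "{f :: 'k \<Rightarrow> complex. f \<in> carrier ell2 \<and> hnorm ell2 f \<le> 1} \<noteq> {}"
    using ell2_zero_closed by (auto simp: hnorm_ell2 intro!: exI[of _ "\<lambda>x. 0"])
  fix f :: "'k \<Rightarrow> complex" assume f: "f \<in> {f \<in> carrier ell2. hnorm ell2 f \<le> 1}"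
  have "0 \<le> K" using assms norm_ge_zero order_trans by blast
  have "hnorm ell2 (mult_op g f) \<le> K * hnorm ell2 f"
    using f assms by (auto simp: mult_op_apply intro!: hnorm_mult_le)
  also have "\<dots> \<le> K"
    using f \<open>0 \<le> K\<close> by (simp add: mult_left_le)
  finally show "hnorm ell2 (mult_op g f) \<le> K" .
qed

text \<open>Tests the operator on the unit vector \<open>point x\<close>. Together with
  \<open>op_norm_mult_op_le\<close> this identifies the operator norm with the supremum norm, and
  later estimates are phrased with pointwise bounds.\<close>

lemma cmod_le_op_norm:
  assumes "bounded (range g)"
  shows "cmod (g x) \<le> op_norm ell2 (mult_op g)"
proof -
  obtain K where K: "K \<ge> 0" "\<And>x. cmod (g x) \<le> K" using assms bounded_rangeE by blast
  have "hnorm ell2 (mult_op g f) \<le> K" if "f \<in> carrier ell2" "hnorm ell2 f \<le> 1" for f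
    using hnorm_mult_le[OF that(1), of g K] K that mult_left_le[OF that(2) K(1)]
    by (simp add: mult_op_apply) 
  then have "bdd_above ((\<lambda>f. hnorm ell2 (mult_op g f)) ` {f \<in> carrier ell2. hnorm ell2 f \<le> 1})"
    by (auto intro!: bdd_aboveI2[of _ _ K])
  then have "hnorm ell2 (mult_op g (point x)) \<le> op_norm ell2 (mult_op g)"
    unfolding op_norm_def by (rule cSUP_upper[rotated]) (simp add: point_in_ell2 hnorm_point)
  moreover have "cmod (mult_op g (point x) x) \<le> hnorm ell2 (mult_op g (point x))"
    by (intro cmod_le_hnorm mult_op_closed assms point_in_ell2)
  ultimately show ?thesis
    by (simp add: mult_op_apply point_in_ell2) (simp add: point_def)
qed

lemma adjoint_mult_op:
  assumes "bounded (range g)"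
  shows "adjoint_op ell2 (mult_op g) = mult_op (\<lambda>x. cnj (g x))"
  unfolding adjoint_op_def
proof (rule the_equality)
  show "mult_op (\<lambda>x. cnj (g x)) \<in> bounded_operators ell2 \<and>
    (\<forall>x\<in>carrier ell2. \<forall>y\<in>carrier ell2.
      hinner ell2 (mult_op g x) y = hinner ell2 x (mult_op (\<lambda>x. cnj (g x)) y))"
  proof (intro conjI ballI mult_op_bounded bounded_range_intros(5) assms)
    fix f h :: "'a \<Rightarrow> complex" assume f: "f \<in> carrier ell2" and h: "h \<in> carrier ell2"
    show "hinner ell2 (mult_op g f) h = hinner ell2 f (mult_op (\<lambda>x. cnj (g x)) h)"
      unfolding mult_op_apply[OF f] mult_op_apply[OF h] ell2_simps complex_cnj_mult complex_cnj_cnj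
      by (rule infsum_cong) (simp only: mult_ac)
  qed
next
  fix S assume S: "S \<in> bounded_operators ell2 \<and>
    (\<forall>x\<in>carrier ell2. \<forall>y\<in>carrier ell2. hinner ell2 (mult_op g x) y = hinner ell2 x (S y))"
  show "S = mult_op (\<lambda>x. cnj (g x))"
  proof (rule extensionalityI)
    show "S \<in> extensional (carrier ell2)"
      using S by (auto simp: bounded_operators_def PiE_iff)
    show "mult_op (\<lambda>x. cnj (g x)) \<in> extensional (carrier ell2)"
      by (simp add: mult_op_def)
    fix f :: "'a \<Rightarrow> complex" assume f: "f \<in> carrier ell2"
    have "S f x = mult_op (\<lambda>x. cnj (g x)) f x" for x
    proof -
      \<comment> \<open>Pairing with \<open>point x\<close> reads off the coordinate at
        \<open>x\<close>, which forces \<open>S\<close> and gives the uniqueness demanded by the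
        definite description of the adjoint.\<close>
      have "hinner ell2 (mult_op g (point x)) f = hinner ell2 (point x) (S f)"
        by (rule S[THEN conjunct2, rule_format, OF point_in_ell2 f])
      also have "\<dots> = cnj (S f x)" by (rule hinner_point)
      also have "hinner ell2 (mult_op g (point x)) f = (\<Sum>\<^sub>\<infinity>y. point x y * (g y * cnj (f y)))"
        by (simp add: mult_op_apply point_in_ell2 mult_ac)
      also have "\<dots> = g x * cnj (f x)" by (rule infsum_point_mult)
      finally have "cnj (g x * cnj (f x)) = S f x" by simp
      then show ?thesis using f by (simp add: mult_op_apply)
    qed
    then show "S f = mult_op (\<lambda>x. cnj (g x)) f" ..
  qed
qed

lemma compose_mult_op:
  assumes "bounded (range h)"
  shows "compose (carrier ell2) (mult_op g) (mult_op h) = mult_op (\<lambda>x. g x * h x)"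
proof (rule extensionalityI[of _ "carrier ell2"])
  fix f :: "'a \<Rightarrow> complex" assume f: "f \<in> carrier ell2"
  have "mult_op g (mult_op h f) = mult_op (\<lambda>x. g x * h x) f"
    using mult_op_closed[OF assms f] by (simp add: mult_op_apply f mult.assoc)
  then show "compose (carrier ell2) (mult_op g) (mult_op h) f = mult_op (\<lambda>x. g x * h x) f"
    by (simp add: compose_def f)
qed (auto simp: mult_op_def compose_def)

text \<open>The algebra is maximal abelian: an operator commuting with all multiplications by
  \<open>point x\<close> acts coordinatewise and is therefore multiplication by its own
  \<open>symbol\<close>. Applied twice, this settles the double commutant.\<close>

lemma commutant_linf: "commutant ell2 linf = (linf :: (('k \<Rightarrow> complex) \<Rightarrow> ('k \<Rightarrow> complex)) set)"
proof
  show "linf \<subseteq> commutant ell2 (linf :: (('k \<Rightarrow> complex) \<Rightarrow> ('k \<Rightarrow> complex)) set)"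
    by (auto simp: commutant_def mult_op_bounded compose_mult_op mult.commute elim!: linfE)
  show "commutant ell2 linf \<subseteq> (linf :: (('k \<Rightarrow> complex) \<Rightarrow> ('k \<Rightarrow> complex)) set)"
  proof
    fix T :: "('k \<Rightarrow> complex) \<Rightarrow> ('k \<Rightarrow> complex)"
    assume T: "T \<in> commutant ell2 linf"
    then have Tb: "T \<in> bounded_operators ell2" by (simp add: commutant_def)
    have T_in: "T f \<in> carrier ell2" if "f \<in> carrier ell2" for f
      using Tb that by (auto simp: bounded_operators_def)
    have T_smult: "T (c \<odot>\<^bsub>ell2\<^esub> f) = c \<odot>\<^bsub>ell2\<^esub> T f" if "f \<in> carrier ell2" for c f
      using Tb that by (auto simp: bounded_operators_def)
    obtain C where C: "\<And>f. f \<in> carrier ell2 \<Longrightarrow> hnorm ell2 (T f) \<le> C * hnorm ell2 f"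
      using Tb unfolding bounded_operators_def by blast
    have "cmod (symbol T x) \<le> C" for x
      using cmod_le_hnorm[OF T_in[OF point_in_ell2], of x x] C[OF point_in_ell2, of x]
      by (simp add: symbol_def hnorm_point)
    then have bd: "bounded (range (symbol T))"
      unfolding bounded_range_iff by blast
    have "T = mult_op (symbol T)"
    proof (rule extensionalityI)
      show "T \<in> extensional (carrier ell2)"
        using Tb by (auto simp: bounded_operators_def PiE_iff)
      show "mult_op (symbol T) \<in> extensional (carrier ell2)"
        by (simp add: mult_op_def)
      fix f :: "'k \<Rightarrow> complex" assume f: "f \<in> carrier ell2"
      have "T f x = symbol T x * f x" for x
      proof -
        \<comment> \<open>Multiplication by \<open>point x\<close> is the rank one projection onto
          the coordinate \<open>x\<close>, so the value of \<open>T f\<close> at \<open>x\<close>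
          depends on \<open>f x\<close> only.\<close>
        have "compose (carrier ell2) T (mult_op (point x)) f
            = compose (carrier ell2) (mult_op (point x)) T f"
          using T mult_op_in_linf[of "point x"] by (auto simp: commutant_def)
        then have "T (\<lambda>y. point x y * f y) x = point x x * T f x"
          using f T_in[OF f] by (simp add: compose_def mult_op_apply)
        moreover have "(\<lambda>y. point x y * f y) = f x \<odot>\<^bsub>ell2\<^esub> point x"
          by (auto simp: point_def)
        moreover have "T (f x \<odot>\<^bsub>ell2\<^esub> point x) = f x \<odot>\<^bsub>ell2\<^esub> T (point x)"
          by (rule T_smult[OF point_in_ell2])
        ultimately show ?thesis
          unfolding symbol_def by (simp only: ell2_simps) (simp add: point_def mult.commute)
      qed
      then show "T f = mult_op (symbol T) f" using f by (simp add: mult_op_apply fun_eq_iff)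
    qed
    then show "T \<in> linf" using bd unfolding linf_def by blast
  qed
qed

lemma von_neumann_algebra_linf: "von_neumann_algebra ell2 (linf :: (('k \<Rightarrow> complex) \<Rightarrow> ('k \<Rightarrow> complex)) set)"
  unfolding von_neumann_algebra_def
proof (intro conjI hilbert_space_ell2 subsetI ballI)
  fix T :: "('k \<Rightarrow> complex) \<Rightarrow> ('k \<Rightarrow> complex)" assume "T \<in> linf"
  then show "T \<in> bounded_operators ell2" "adjoint_op ell2 T \<in> linf"
    by (auto elim!: linfE simp: mult_op_bounded adjoint_mult_op)
qed (simp add: commutant_linf)

section \<open>Bounded functions as a finite normed star-algebra\<close>

abbreviation linf_alg :: "(('k \<Rightarrow> complex) \<Rightarrow> ('k \<Rightarrow> complex)) nstar_algebra" where
  "linf_alg \<equiv> vn_alg ell2 linf"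

lemma linf_alg_simps [simp]:
  "carrier linf_alg = linf"
  "\<one>\<^bsub>linf_alg\<^esub> = mult_op (\<lambda>x. 1)"
  "vnorm linf_alg = op_norm ell2"
  by (auto simp: vn_alg_def mult_op_def)

lemma linf_alg_ops [simp]:
  "mult_op g \<oplus>\<^bsub>linf_alg\<^esub> mult_op h = mult_op (\<lambda>x. g x + h x)"
  "bounded (range h) \<Longrightarrow> mult_op g \<otimes>\<^bsub>linf_alg\<^esub> mult_op h = mult_op (\<lambda>x. g x * h x)"
  "c \<odot>\<^bsub>linf_alg\<^esub> mult_op g = mult_op (\<lambda>x. c * g x)"
  "bounded (range g) \<Longrightarrow> star linf_alg (mult_op g) = mult_op (\<lambda>x. cnj (g x))"
proof -
  show "mult_op g \<oplus>\<^bsub>linf_alg\<^esub> mult_op h = mult_op (\<lambda>x. g x + h x)"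
    "c \<odot>\<^bsub>linf_alg\<^esub> mult_op g = mult_op (\<lambda>x. c * g x)"
    by (auto simp: vn_alg_def mult_op_def algebra_simps intro!: restrict_ext)
  show "bounded (range h) \<Longrightarrow> mult_op g \<otimes>\<^bsub>linf_alg\<^esub> mult_op h = mult_op (\<lambda>x. g x * h x)"
    by (drule compose_mult_op[where g = g]) (simp add: vn_alg_def)
  show "bounded (range g) \<Longrightarrow> star linf_alg (mult_op g) = mult_op (\<lambda>x. cnj (g x))"
    by (drule adjoint_mult_op) (simp add: vn_alg_def)
qed

lemma linf_alg_commute:
  assumes "S \<in> linf" "T \<in> linf"
  shows "S \<otimes>\<^bsub>linf_alg\<^esub> T = T \<otimes>\<^bsub>linf_alg\<^esub> S"
proof -
  obtain g where g: "bounded (range g)" "S = mult_op g" using assms(1) by (rule linfE)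
  obtain h where h: "bounded (range h)" "T = mult_op h" using assms(2) by (rule linfE)
  show ?thesis unfolding g(2) h(2) linf_alg_ops(2)[OF g(1)] linf_alg_ops(2)[OF h(1)]
    by (simp add: mult.commute)
qed

lemma star_linf_closed:
  assumes "T \<in> linf"
  shows "star linf_alg T \<in> linf"
proof -
  obtain g where g: "bounded (range g)" "T = mult_op g" using assms by (rule linfE)
  then show ?thesis by simp
qed

lemma finite_algebra_linf: "finite_algebra linf_alg"
proof -
  have "p = \<one>\<^bsub>linf_alg\<^esub>" if p: "mvn_equivalent linf_alg \<one>\<^bsub>linf_alg\<^esub> p" for p
  proof -
    obtain v where v: "v \<in> linf" and "star linf_alg v \<otimes>\<^bsub>linf_alg\<^esub> v = \<one>\<^bsub>linf_alg\<^esub>"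
      and "v \<otimes>\<^bsub>linf_alg\<^esub> star linf_alg v = p"
      using p unfolding mvn_equivalent_def linf_alg_simps(1) by blast
    \<comment> \<open>Commutativity identifies the initial projection of \<open>v\<close>, which is
      the unit, with its final projection \<open>p\<close>.\<close>
    then show ?thesis
      using linf_alg_commute[OF star_linf_closed[OF v] v] by (simp only:)
  qed
  then show ?thesis unfolding finite_algebra_def by blast
qed

section \<open>The dual and the bidual of the algebra of bounded functions\<close>

lemma dual_simps [simp]:
  "carrier (dual V) = bounded_functionals V"
  "add (dual V) = (\<lambda>f g. \<lambda>x\<in>carrier V. f x + g x)"
  "smult (dual V) = (\<lambda>c f. \<lambda>x\<in>carrier V. c * f x)"
  "zero (dual V) = (\<lambda>x\<in>carrier V. 0)"
  "vnorm (dual V) = (\<lambda>f. SUP x\<in>{x \<in> carrier V. vnorm V x \<le> 1}. cmod (f x))"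
  by (simp_all add: dual_def)

abbreviation linf_dual :: "((('k \<Rightarrow> complex) \<Rightarrow> ('k \<Rightarrow> complex)) \<Rightarrow> complex) set" where
  "linf_dual \<equiv> bounded_functionals linf_alg"

abbreviation linf_bidual :: "(((('k \<Rightarrow> complex) \<Rightarrow> ('k \<Rightarrow> complex)) \<Rightarrow> complex) \<Rightarrow> complex) set" where
  "linf_bidual \<equiv> bounded_functionals (dual linf_alg)"

text \<open>Functionals are constructed from maps on functions by composing with
  \<open>symbol\<close>. The bound is asked for every pointwise bound \<open>K\<close> of
  \<open>g\<close>, so no instance has to handle the operator norm.\<close>

lemma linf_dualI:
  fixes F :: "('k \<Rightarrow> complex) \<Rightarrow> complex"
  assumes add: "\<And>g h. bounded (range g) \<Longrightarrow> bounded (range h) \<Longrightarrow> F (\<lambda>x. g x + h x) = F g + F h"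
    and smult: "\<And>c g. bounded (range g) \<Longrightarrow> F (\<lambda>x. c * g x) = c * F g"
    and bound: "\<And>g K. (\<And>x. cmod (g x) \<le> K) \<Longrightarrow> cmod (F g) \<le> C * K"
  shows "(\<lambda>T\<in>linf. F (symbol T)) \<in> linf_dual"
  unfolding bounded_functionals_def mem_Collect_eq linf_alg_simps
proof (intro conjI ballI allI exI)
  fix S T :: "('k \<Rightarrow> complex) \<Rightarrow> ('k \<Rightarrow> complex)" and c
  assume "S \<in> linf"
  then obtain g where g: "bounded (range g)" "S = mult_op g" by (rule linfE)
  show "(\<lambda>T\<in>linf. F (symbol T)) (c \<odot>\<^bsub>linf_alg\<^esub> S) = c * (\<lambda>T\<in>linf. F (symbol T)) S"
    using g by (simp add: smult)
  show "cmod ((\<lambda>T\<in>linf. F (symbol T)) S) \<le> C * op_norm ell2 S"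
    using g by (simp add: bound cmod_le_op_norm)
  assume "T \<in> linf"
  then obtain h where h: "bounded (range h)" "T = mult_op h" by (rule linfE)
  show "(\<lambda>T\<in>linf. F (symbol T)) (S \<oplus>\<^bsub>linf_alg\<^esub> T) =
      (\<lambda>T\<in>linf. F (symbol T)) S + (\<lambda>T\<in>linf. F (symbol T)) T"
    using g h by (simp add: add)
qed simp

lemma linf_dual_extensional: "\<phi> \<in> linf_dual \<Longrightarrow> \<phi> \<in> extensional linf"
  by (simp add: bounded_functionals_def)

lemma linf_dual_add:
  assumes "\<phi> \<in> linf_dual" "bounded (range g)" "bounded (range h)"
  shows "\<phi> (mult_op (\<lambda>x. g x + h x)) = \<phi> (mult_op g) + \<phi> (mult_op h)"
proof -
  have "\<phi> (mult_op g \<oplus>\<^bsub>linf_alg\<^esub> mult_op h) = \<phi> (mult_op g) + \<phi> (mult_op h)"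
    using assms unfolding bounded_functionals_def by (simp del: linf_alg_ops)
  then show ?thesis by simp
qed

lemma linf_dual_smult:
  assumes "\<phi> \<in> linf_dual" "bounded (range g)"
  shows "\<phi> (mult_op (\<lambda>x. c * g x)) = c * \<phi> (mult_op g)"
proof -
  have "\<phi> (c \<odot>\<^bsub>linf_alg\<^esub> mult_op g) = c * \<phi> (mult_op g)"
    using assms unfolding bounded_functionals_def by (simp del: linf_alg_ops)
  then show ?thesis by simp
qed

lemma linf_dual_sum:
  assumes "\<phi> \<in> linf_dual" "\<And>i. bounded (range (g i))"
  shows "\<phi> (mult_op (\<lambda>x. \<Sum>i\<in>F. c i * g i x)) = (\<Sum>i\<in>F. c i * \<phi> (mult_op (g i)))"
proof (induction F rule: infinite_finite_induct)
  case (insert i F)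
  have "\<phi> (mult_op (\<lambda>x. c i * g i x + (\<Sum>i\<in>F. c i * g i x))) =
      \<phi> (mult_op (\<lambda>x. c i * g i x)) + \<phi> (mult_op (\<lambda>x. \<Sum>i\<in>F. c i * g i x))"
    by (intro linf_dual_add assms bounded_range_intros bounded_range_sum)
  then show ?case
    using insert by (simp add: linf_dual_smult assms)
\<comment> \<open>For the empty and for an infinite index set the sums are 0 by convention, so
  \<open>\<phi>\<close> must vanish at the zero operator; the scalar 0 gives this.\<close>
qed (use linf_dual_smult[OF assms(1), of "\<lambda>x. 0" 0] in simp_all)

lemma linf_dual_bound:
  fixes \<phi> :: "(('k \<Rightarrow> complex) \<Rightarrow> ('k \<Rightarrow> complex)) \<Rightarrow> complex"
  assumes "\<phi> \<in> linf_dual"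
  obtains C where "C \<ge> 0" "\<And>g K. (\<And>x. cmod (g x) \<le> K) \<Longrightarrow> cmod (\<phi> (mult_op g)) \<le> C * K"
proof -
  obtain C where C: "\<And>T. T \<in> linf \<Longrightarrow> cmod (\<phi> T) \<le> C * op_norm ell2 T"
    using assms unfolding bounded_functionals_def mem_Collect_eq linf_alg_simps by blast
  \<comment> \<open>The definition of a bounded functional prescribes no sign for its constant;
    \<open>max C 0\<close> allows multiplying inequalities by it.\<close>
  have bound: "cmod (\<phi> (mult_op g)) \<le> max C 0 * K" if K: "\<And>x. cmod (g x) \<le> K" for g K
  proof -
    have g: "bounded (range g)" using K bounded_range_iff by blast
    have "0 \<le> op_norm ell2 (mult_op g)"
      using cmod_le_op_norm[OF g, of undefined] norm_ge_zero order_trans by blast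
    have "cmod (\<phi> (mult_op g)) \<le> C * op_norm ell2 (mult_op g)"
      using C g by simp
    also have "\<dots> \<le> max C 0 * op_norm ell2 (mult_op g)"
      by (intro mult_right_mono \<open>0 \<le> op_norm ell2 (mult_op g)\<close>) simp
    also have "\<dots> \<le> max C 0 * K"
      by (intro mult_left_mono op_norm_mult_op_le K) simp
    finally show ?thesis .
  qed
  show thesis by (rule that[of "max C 0"]) (simp, rule bound)
qed

lemma linf_dual_eqI:
  assumes "\<phi> \<in> linf_dual" "\<psi> \<in> linf_dual"
    and "\<And>g. bounded (range g) \<Longrightarrow> \<phi> (mult_op g) = \<psi> (mult_op g)"
  shows "\<phi> = \<psi>"
proof (rule extensionalityI)
  show "\<phi> \<in> extensional linf" "\<psi> \<in> extensional linf"
    using assms(1,2) by (auto intro: linf_dual_extensional)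
  fix T :: "('a \<Rightarrow> complex) \<Rightarrow> ('a \<Rightarrow> complex)" assume "T \<in> linf"
  then obtain g where "bounded (range g)" "T = mult_op g" by (rule linfE)
  then show "\<phi> T = \<psi> T" using assms(3) by simp
qed

section \<open>The dual norm and the elements of the bidual\<close>

lemma linf_dual_vnorm_le:
  fixes \<phi> :: "(('k \<Rightarrow> complex) \<Rightarrow> ('k \<Rightarrow> complex)) \<Rightarrow> complex"
  assumes "\<And>g. (\<And>x. cmod (g x) \<le> 1) \<Longrightarrow> cmod (\<phi> (mult_op g)) \<le> D"
  shows "vnorm (dual linf_alg) \<phi> \<le> D"
  unfolding dual_simps linf_alg_simps
proof (rule cSUP_least)
  have "op_norm ell2 (mult_op (\<lambda>x::'k. 0)) \<le> 1" by (rule op_norm_mult_op_le) simp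
  then have "mult_op (\<lambda>x::'k. 0) \<in> {T \<in> linf. op_norm ell2 T \<le> 1}" by simp
  then show "{T :: ('k \<Rightarrow> complex) \<Rightarrow> ('k \<Rightarrow> complex). T \<in> linf \<and> op_norm ell2 T \<le> 1} \<noteq> {}" by blast
  fix T :: "('k \<Rightarrow> complex) \<Rightarrow> ('k \<Rightarrow> complex)" assume T: "T \<in> {T \<in> linf. op_norm ell2 T \<le> 1}"
  then obtain g where g: "bounded (range g)" "T = mult_op g" using linfE by blast
  have "cmod (g x) \<le> 1" for x using cmod_le_op_norm[OF g(1), of x] T g(2) by simp
  then show "cmod (\<phi> T) \<le> D" using assms g(2) by simp
qed

lemma linf_dual_le_vnorm:
  fixes \<phi> :: "(('k \<Rightarrow> complex) \<Rightarrow> ('k \<Rightarrow> complex)) \<Rightarrow> complex"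
  assumes "\<phi> \<in> linf_dual" and g: "\<And>x. cmod (g x) \<le> 1"
  shows "cmod (\<phi> (mult_op g)) \<le> vnorm (dual linf_alg) \<phi>"
proof -
  obtain C where C: "C \<ge> 0" "\<And>g K. (\<And>x. cmod (g x) \<le> K) \<Longrightarrow> cmod (\<phi> (mult_op g)) \<le> C * K"
    using linf_dual_bound[OF assms(1)] by blast
  have "cmod (\<phi> T) \<le> C" if T: "T \<in> linf" "op_norm ell2 T \<le> 1" for T
  proof -
    obtain h where h: "bounded (range h)" "T = mult_op h" using T(1) by (rule linfE)
    have "cmod (h x) \<le> 1" for x using cmod_le_op_norm[OF h(1), of x] T(2) h(2) by simp
    then show ?thesis using C(2)[of h 1] h(2) by simp
  qed
  then have "bdd_above ((\<lambda>T. cmod (\<phi> T)) ` {T \<in> linf. op_norm ell2 T \<le> 1})"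
    by (intro bdd_aboveI2[of _ _ C]) auto
  moreover have "mult_op g \<in> {T \<in> linf. op_norm ell2 T \<le> 1}"
    using op_norm_mult_op_le[of g, OF g] g bounded_range_iff by auto
  ultimately show ?thesis
    unfolding dual_simps linf_alg_simps by (intro cSUP_upper)
qed

text \<open>The last premise is contractivity, with \<open>D\<close> standing for any bound of
  \<open>\<phi>\<close> on the unit ball; this form spares the supremum in the dual norm. It fits
  \<open>atomic_proj\<close> and its negative.\<close>

lemma linf_bidualI:
  assumes "X \<in> extensional linf_dual"
    and "\<And>\<phi> \<psi>. \<phi> \<in> linf_dual \<Longrightarrow> \<psi> \<in> linf_dual \<Longrightarrow> X (\<lambda>T\<in>linf. \<phi> T + \<psi> T) = X \<phi> + X \<psi>"
    and "\<And>c \<phi>. \<phi> \<in> linf_dual \<Longrightarrow> X (\<lambda>T\<in>linf. c * \<phi> T) = c * X \<phi>"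
    and "\<And>\<phi> D. \<phi> \<in> linf_dual \<Longrightarrow> (\<And>g. (\<And>x. cmod (g x) \<le> 1) \<Longrightarrow> cmod (\<phi> (mult_op g)) \<le> D)
      \<Longrightarrow> cmod (X \<phi>) \<le> D"
  shows "X \<in> linf_bidual"
proof -
  have "cmod (X \<phi>) \<le> 1 * vnorm (dual linf_alg) \<phi>" if "\<phi> \<in> linf_dual" for \<phi>
    using assms(4)[OF that linf_dual_le_vnorm[OF that]] by simp
  then have "\<exists>C. \<forall>\<phi>\<in>linf_dual. cmod (X \<phi>) \<le> C * vnorm (dual linf_alg) \<phi>"
    by blast
  then show ?thesis
    unfolding bounded_functionals_def[of "dual _"] mem_Collect_eq
    unfolding dual_simps(1,2,3) linf_alg_simps(1) using assms(1-3) by blast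
qed

lemma linf_bidual_extensional: "X \<in> linf_bidual \<Longrightarrow> X \<in> extensional linf_dual"
  by (simp add: bounded_functionals_def[of "dual _"])

lemma linf_bidual_add:
  assumes "X \<in> linf_bidual" "\<phi> \<in> linf_dual" "\<psi> \<in> linf_dual"
  shows "X (\<lambda>T\<in>linf. \<phi> T + \<psi> T) = X \<phi> + X \<psi>"
  using assms unfolding bounded_functionals_def[of "dual _"] by simp

lemma linf_bidual_smult:
  assumes "X \<in> linf_bidual" "\<phi> \<in> linf_dual"
  shows "X (\<lambda>T\<in>linf. c * \<phi> T) = c * X \<phi>"
  using assms unfolding bounded_functionals_def[of "dual _"] by simp

lemma linf_bidual_bound:
  fixes X :: "((('k \<Rightarrow> complex) \<Rightarrow> ('k \<Rightarrow> complex)) \<Rightarrow> complex) \<Rightarrow> complex"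
  assumes "X \<in> linf_bidual"
  obtains C where "C \<ge> 0" "\<And>\<phi> D. \<phi> \<in> linf_dual \<Longrightarrow>
    (\<And>g. (\<And>x. cmod (g x) \<le> 1) \<Longrightarrow> cmod (\<phi> (mult_op g)) \<le> D) \<Longrightarrow> cmod (X \<phi>) \<le> C * D"
proof -
  obtain C where C: "\<And>\<phi>. \<phi> \<in> linf_dual \<Longrightarrow> cmod (X \<phi>) \<le> C * vnorm (dual linf_alg) \<phi>"
    using assms unfolding bounded_functionals_def[of "dual _"] mem_Collect_eq dual_simps(1) by blast
  have bound: "cmod (X \<phi>) \<le> max C 0 * D"
    if \<phi>: "\<phi> \<in> linf_dual" and D: "\<And>g. (\<And>x. cmod (g x) \<le> 1) \<Longrightarrow> cmod (\<phi> (mult_op g)) \<le> D" for \<phi> D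
  proof -
    have "0 \<le> vnorm (dual linf_alg) \<phi>"
      using linf_dual_le_vnorm[OF \<phi>, of "\<lambda>x. 0"] norm_ge_zero[of "\<phi> (mult_op (\<lambda>x. 0))"]
      by (simp del: dual_simps norm_ge_zero)
    then have "C * vnorm (dual linf_alg) \<phi> \<le> max C 0 * vnorm (dual linf_alg) \<phi>"
      by (intro mult_right_mono) simp
    also have "\<dots> \<le> max C 0 * D"
      by (intro mult_left_mono linf_dual_vnorm_le D) auto
    finally show ?thesis using C[OF \<phi>] by linarith
  qed
  show thesis by (rule that[of "max C 0"]) (simp, rule bound, assumption, blast)
qed

text \<open>The functional \<open>\<phi>(\<cdot> h)\<close>; here \<open>h\<close> is a bounded function instead of an operator.\<close>

definition dshift :: "((('k \<Rightarrow> complex) \<Rightarrow> ('k \<Rightarrow> complex)) \<Rightarrow> complex) \<Rightarrow> ('k \<Rightarrow> complex) \<Rightarrow>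
    (('k \<Rightarrow> complex) \<Rightarrow> ('k \<Rightarrow> complex)) \<Rightarrow> complex" where
  "dshift \<phi> h = (\<lambda>T\<in>linf. \<phi> (mult_op (\<lambda>x. symbol T x * h x)))"

lemma dshift_apply: "bounded (range g) \<Longrightarrow> dshift \<phi> h (mult_op g) = \<phi> (mult_op (\<lambda>x. g x * h x))"
  by (simp add: dshift_def)

lemma dshift_closed:
  assumes "\<phi> \<in> linf_dual" "bounded (range h)"
  shows "dshift \<phi> h \<in> linf_dual"
proof -
  obtain C where C: "C \<ge> 0" "\<And>g K. (\<And>x. cmod (g x) \<le> K) \<Longrightarrow> cmod (\<phi> (mult_op g)) \<le> C * K"
    using linf_dual_bound[OF assms(1)] by blast
  obtain L where L: "L \<ge> 0" "\<And>x. cmod (h x) \<le> L" using bounded_rangeE[OF assms(2)] by blast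
  have "(\<lambda>T\<in>linf. (\<lambda>g. \<phi> (mult_op (\<lambda>x. g x * h x))) (symbol T)) \<in> linf_dual"
  proof (rule linf_dualI[where C = "C * L"])
    fix g g' :: "'a \<Rightarrow> complex" and c K
    show "\<phi> (mult_op (\<lambda>x. (g x + g' x) * h x)) = \<phi> (mult_op (\<lambda>x. g x * h x)) + \<phi> (mult_op (\<lambda>x. g' x * h x))"
      if "bounded (range g)" "bounded (range g')"
      unfolding distrib_right using that assms by (intro linf_dual_add bounded_range_intros)
    show "\<phi> (mult_op (\<lambda>x. c * g x * h x)) = c * \<phi> (mult_op (\<lambda>x. g x * h x))" if "bounded (range g)"
      unfolding mult.assoc using that assms by (intro linf_dual_smult bounded_range_intros)
    assume K: "\<And>x. cmod (g x) \<le> K"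
    have "0 \<le> K" using K norm_ge_zero order_trans by blast
    have "cmod (g x * h x) \<le> K * L" for x
      unfolding norm_mult using K L \<open>0 \<le> K\<close> by (intro mult_mono) auto
    then show "cmod (\<phi> (mult_op (\<lambda>x. g x * h x))) \<le> C * L * K"
      using C(2)[of "\<lambda>x. g x * h x" "K * L"] by (simp add: mult_ac)
  qed
  then show ?thesis by (simp add: dshift_def)
qed

section \<open>The action of the bidual on the dual\<close>

lemma dshift_dshift:
  assumes "\<phi> \<in> linf_dual" "bounded (range g)" "bounded (range h)"
  shows "dshift (dshift \<phi> g) h = dshift \<phi> (\<lambda>x. h x * g x)"
  using assms by (intro linf_dual_eqI dshift_closed bounded_range_intros) (simp_all add: dshift_apply mult.assoc)

lemma dshift_one: "\<phi> \<in> linf_dual \<Longrightarrow> dshift \<phi> (\<lambda>x. 1) = \<phi>"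
  by (intro linf_dual_eqI dshift_closed) (simp_all add: dshift_apply)

text \<open>Unfolds the Arens product with an evaluation: the map sending \<open>S\<close> to the
  value of \<open>\<phi>\<close> at \<open>S\<close> times \<open>mult_op h\<close> is
  \<open>dshift \<phi> h\<close>. Statements about \<open>translate\<close> are reduced to shifts
  through this formula.\<close>

lemma translate_apply:
  assumes "\<phi> \<in> linf_dual" "bounded (range h)"
  shows "translate linf_alg \<phi> X (mult_op h) = X (dshift \<phi> h)"
proof -
  have "(\<lambda>S\<in>linf. evaluation linf_alg (mult_op h) (\<lambda>T\<in>linf. \<phi> (S \<otimes>\<^bsub>linf_alg\<^esub> T))) = dshift \<phi> h"
    unfolding dshift_def
  proof (rule restrict_ext)
    fix S :: "('a \<Rightarrow> complex) \<Rightarrow> ('a \<Rightarrow> complex)" assume "S \<in> linf"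
    then obtain g where g: "bounded (range g)" "S = mult_op g" by (rule linfE)
    have "(\<lambda>T\<in>linf. \<phi> (S \<otimes>\<^bsub>linf_alg\<^esub> T)) = dshift \<phi> g"
      unfolding dshift_def
    proof (rule restrict_ext)
      fix T :: "('a \<Rightarrow> complex) \<Rightarrow> ('a \<Rightarrow> complex)" assume "T \<in> linf"
      then obtain f where "bounded (range f)" "T = mult_op f" by (rule linfE)
      then show "\<phi> (S \<otimes>\<^bsub>linf_alg\<^esub> T) = \<phi> (mult_op (\<lambda>x. symbol T x * g x))"
        using g by (simp add: mult.commute)
    qed
    then show "evaluation linf_alg (mult_op h) (\<lambda>T\<in>linf. \<phi> (S \<otimes>\<^bsub>linf_alg\<^esub> T))
        = \<phi> (mult_op (\<lambda>x. symbol S x * h x))"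
      using g dshift_closed[OF assms(1) g(1)] assms
      by (simp add: evaluation_def dshift_apply mult.commute)
  qed
  then show ?thesis
    using assms by (simp add: translate_def bidual_def)
qed

lemma translate_extensional: "translate linf_alg \<phi> X \<in> extensional linf"
  by (simp add: translate_def)

lemma translate_closed:
  assumes "\<phi> \<in> linf_dual" "X \<in> linf_bidual"
  shows "translate linf_alg \<phi> X \<in> linf_dual"
proof -
  obtain C where C: "C \<ge> 0" "\<And>g K. (\<And>x. cmod (g x) \<le> K) \<Longrightarrow> cmod (\<phi> (mult_op g)) \<le> C * K"
    using linf_dual_bound[OF assms(1)] by blast
  obtain B where B: "B \<ge> 0" "\<And>\<phi> D. \<phi> \<in> linf_dual \<Longrightarrow>
    (\<And>g. (\<And>x. cmod (g x) \<le> 1) \<Longrightarrow> cmod (\<phi> (mult_op g)) \<le> D) \<Longrightarrow> cmod (X \<phi>) \<le> B * D"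
    using linf_bidual_bound[OF assms(2)] by blast
  have "(\<lambda>T\<in>linf. (\<lambda>g. X (dshift \<phi> g)) (symbol T)) \<in> linf_dual"
  \<comment> \<open>\<open>C\<close> bounds \<open>\<phi>\<close> and \<open>B\<close> bounds
    \<open>X\<close>; shifting \<open>\<phi>\<close> by a function bounded by \<open>K\<close> gives
    a functional bounded by \<open>C * K\<close> on the unit ball.\<close>
  proof (rule linf_dualI[where C = "B * C"])
    fix g g' :: "'a \<Rightarrow> complex" and c K
    show "X (dshift \<phi> (\<lambda>x. g x + g' x)) = X (dshift \<phi> g) + X (dshift \<phi> g')"
      if g: "bounded (range g)" "bounded (range g')"
    proof -
      have "dshift \<phi> (\<lambda>x. g x + g' x) = (\<lambda>T\<in>linf. dshift \<phi> g T + dshift \<phi> g' T)"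
        unfolding dshift_def
      proof (rule restrict_ext)
        fix T :: "('a \<Rightarrow> complex) \<Rightarrow> ('a \<Rightarrow> complex)" assume T: "T \<in> linf"
        then obtain f where f: "bounded (range f)" "T = mult_op f" by (rule linfE)
        have "\<phi> (mult_op (\<lambda>x. f x * g x + f x * g' x)) =
            \<phi> (mult_op (\<lambda>x. f x * g x)) + \<phi> (mult_op (\<lambda>x. f x * g' x))"
          using f g assms by (intro linf_dual_add bounded_range_intros)
        then show "\<phi> (mult_op (\<lambda>x. symbol T x * (g x + g' x))) =
          (\<lambda>T\<in>linf. \<phi> (mult_op (\<lambda>x. symbol T x * g x))) T + (\<lambda>T\<in>linf. \<phi> (mult_op (\<lambda>x. symbol T x * g' x))) T"
          using f by (simp add: distrib_left)
      qed
      then show ?thesis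
        using g assms by (simp add: linf_bidual_add dshift_closed)
    qed
    show "X (dshift \<phi> (\<lambda>x. c * g x)) = c * X (dshift \<phi> g)" if g: "bounded (range g)"
    proof -
      have "dshift \<phi> (\<lambda>x. c * g x) = (\<lambda>T\<in>linf. c * dshift \<phi> g T)"
        unfolding dshift_def
      proof (rule restrict_ext)
        fix T :: "('a \<Rightarrow> complex) \<Rightarrow> ('a \<Rightarrow> complex)" assume T: "T \<in> linf"
        then obtain f where f: "bounded (range f)" "T = mult_op f" by (rule linfE)
        have "\<phi> (mult_op (\<lambda>x. c * (f x * g x))) = c * \<phi> (mult_op (\<lambda>x. f x * g x))"
          using f g assms by (intro linf_dual_smult bounded_range_intros)
        then show "\<phi> (mult_op (\<lambda>x. symbol T x * (c * g x))) =
          c * (\<lambda>T\<in>linf. \<phi> (mult_op (\<lambda>x. symbol T x * g x))) T"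
          using f by (simp add: mult.left_commute)
      qed
      then show ?thesis
        using g assms by (simp add: linf_bidual_smult dshift_closed)
    qed
    assume K: "\<And>x. cmod (g x) \<le> K"
    then have g: "bounded (range g)" using bounded_range_iff by blast
    have "0 \<le> K" using K norm_ge_zero order_trans by blast
    have "cmod (dshift \<phi> g (mult_op f)) \<le> C * K" if f: "\<And>x. cmod (f x) \<le> 1" for f
    proof -
      have "cmod (f x * g x) \<le> 1 * K" for x
        unfolding norm_mult using K f \<open>0 \<le> K\<close> by (intro mult_mono) auto
      then have "cmod (\<phi> (mult_op (\<lambda>x. f x * g x))) \<le> C * K"
        using C(2)[of "\<lambda>x. f x * g x" K] by simp
      moreover have "bounded (range f)" using f bounded_range_iff by blast
      ultimately show ?thesis by (simp add: dshift_apply)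
    qed
    then have "cmod (X (dshift \<phi> g)) \<le> B * (C * K)"
      using B(2) dshift_closed[OF assms(1) g] by blast
    then show "cmod (X (dshift \<phi> g)) \<le> B * C * K" by (simp add: mult.assoc)
  qed
  also have "(\<lambda>T\<in>linf. (\<lambda>g. X (dshift \<phi> g)) (symbol T)) = translate linf_alg \<phi> X"
  proof (rule extensionalityI[OF _ translate_extensional])
    fix T :: "('a \<Rightarrow> complex) \<Rightarrow> ('a \<Rightarrow> complex)" assume T: "T \<in> linf"
    then obtain f where "bounded (range f)" "T = mult_op f" by (rule linfE)
    then show "(\<lambda>T\<in>linf. (\<lambda>g. X (dshift \<phi> g)) (symbol T)) T = translate linf_alg \<phi> X T"
      using assms by (simp add: translate_apply)
  qed simp
  finally show ?thesis .
qed

section \<open>The Arens product\<close>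

lemma bidual_simps [simp]:
  "carrier (bidual A) = bounded_functionals (dual A)"
  "one (bidual A) = evaluation A \<one>\<^bsub>A\<^esub>"
  "zero (bidual A) = (\<lambda>\<phi>\<in>bounded_functionals A. 0)"
  "add (bidual A) = (\<lambda>X Y. \<lambda>\<phi>\<in>bounded_functionals A. X \<phi> + Y \<phi>)"
  by (simp_all add: bidual_def)

text \<open>Commutativity turns the inner functional of the Arens product into a shift, so that the
  argument handed to \<open>X\<close> is a translation by \<open>Y\<close>.\<close>

lemma bidual_mult_apply:
  assumes "\<phi> \<in> linf_dual"
  shows "(X \<otimes>\<^bsub>bidual linf_alg\<^esub> Y) \<phi> = X (translate linf_alg \<phi> Y)"
proof -
  have "(\<lambda>S\<in>linf. Y (\<lambda>T\<in>linf. \<phi> (S \<otimes>\<^bsub>linf_alg\<^esub> T))) = translate linf_alg \<phi> Y"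
  proof (rule extensionalityI[OF _ translate_extensional])
    fix S :: "('a \<Rightarrow> complex) \<Rightarrow> ('a \<Rightarrow> complex)" assume S: "S \<in> linf"
    then obtain g where g: "bounded (range g)" "S = mult_op g" by (rule linfE)
    have "(\<lambda>T\<in>linf. \<phi> (S \<otimes>\<^bsub>linf_alg\<^esub> T)) = dshift \<phi> g"
      unfolding dshift_def
    proof (rule restrict_ext)
      fix T :: "('a \<Rightarrow> complex) \<Rightarrow> ('a \<Rightarrow> complex)" assume "T \<in> linf"
      then obtain f where "bounded (range f)" "T = mult_op f" by (rule linfE)
      then show "\<phi> (S \<otimes>\<^bsub>linf_alg\<^esub> T) = \<phi> (mult_op (\<lambda>x. symbol T x * g x))"
        using g by (simp add: mult.commute)
    qed
    then show "(\<lambda>S\<in>linf. Y (\<lambda>T\<in>linf. \<phi> (S \<otimes>\<^bsub>linf_alg\<^esub> T))) S = translate linf_alg \<phi> Y S"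
      using S g assms by (simp add: translate_apply)
  qed simp
  then show ?thesis using assms by (simp add: bidual_def)
qed

lemma bidual_mult_extensional: "X \<otimes>\<^bsub>bidual linf_alg\<^esub> Y \<in> extensional linf_dual"
  by (simp add: bidual_def)

lemma dshift_translate:
  assumes "\<phi> \<in> linf_dual" "Y \<in> linf_bidual" "bounded (range h)"
  shows "dshift (translate linf_alg \<phi> Y) h = translate linf_alg (dshift \<phi> h) Y"
  using assms
  by (intro linf_dual_eqI dshift_closed translate_closed)
    (simp_all add: dshift_apply translate_apply dshift_closed dshift_dshift mult.commute)

text \<open>Associativity of the Arens product, read as an action on the dual. For idempotent
  \<open>X\<close> it shows that every translate by \<open>X\<close> is fixed by \<open>X\<close>,
  which is what drives the uniqueness proof.\<close>

lemma translate_translate: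
  assumes "\<phi> \<in> linf_dual" "X \<in> linf_bidual" "Y \<in> linf_bidual"
  shows "translate linf_alg (translate linf_alg \<phi> Y) X = translate linf_alg \<phi> (X \<otimes>\<^bsub>bidual linf_alg\<^esub> Y)"
proof (rule extensionalityI[OF translate_extensional translate_extensional])
  fix T :: "('a \<Rightarrow> complex) \<Rightarrow> ('a \<Rightarrow> complex)" assume T: "T \<in> linf"
  then obtain g where "bounded (range g)" "T = mult_op g" by (rule linfE)
  then show "translate linf_alg (translate linf_alg \<phi> Y) X T
      = translate linf_alg \<phi> (X \<otimes>\<^bsub>bidual linf_alg\<^esub> Y) T"
    using assms by (simp add: translate_apply translate_closed dshift_translate bidual_mult_apply dshift_closed)
qed

text \<open>Recovers an element of the bidual from its action, so equal translations give equal
  elements.\<close>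

lemma translate_one: "\<phi> \<in> linf_dual \<Longrightarrow> translate linf_alg \<phi> X (mult_op (\<lambda>x. 1)) = X \<phi>"
  by (simp add: translate_apply dshift_one)

text \<open>The image of \<open>\<phi> \<mapsto> z\<phi>\<close> is fixed pointwise by \<open>z'\<close>, so \<open>z'z = z\<close>, and symmetrically.\<close>

lemma central_projection_unique:
  fixes z z' :: "((('k \<Rightarrow> complex) \<Rightarrow> ('k \<Rightarrow> complex)) \<Rightarrow> complex) \<Rightarrow> complex"
  assumes z: "projection (bidual linf_alg) z" "central (bidual linf_alg) z"
    and z': "projection (bidual linf_alg) z'"
    and eq: "{\<phi> \<in> linf_dual. \<phi> = translate linf_alg \<phi> z} = {\<phi> \<in> linf_dual. \<phi> = translate linf_alg \<phi> z'}"
  shows "z = z'"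
proof -
  have absorb: "(Y \<otimes>\<^bsub>bidual linf_alg\<^esub> X) \<phi> = X \<phi>"
    if X: "projection (bidual linf_alg) X" and Y: "projection (bidual linf_alg) Y" and \<phi>: "\<phi> \<in> linf_dual"
      and eq: "{\<phi> \<in> linf_dual. \<phi> = translate linf_alg \<phi> X} = {\<phi> \<in> linf_dual. \<phi> = translate linf_alg \<phi> Y}"
    for X Y and \<phi> :: "(('k \<Rightarrow> complex) \<Rightarrow> ('k \<Rightarrow> complex)) \<Rightarrow> complex"
  proof -
    have in_bi: "X \<in> linf_bidual" "Y \<in> linf_bidual" using X Y by (auto simp: projection_def)
    have "translate linf_alg (translate linf_alg \<phi> X) X = translate linf_alg \<phi> X"
      using X translate_translate[OF \<phi> in_bi(1) in_bi(1)] by (simp add: projection_def)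
    then have "translate linf_alg \<phi> X \<in> {\<phi> \<in> linf_dual. \<phi> = translate linf_alg \<phi> X}"
      using translate_closed[OF \<phi> in_bi(1)] by (intro CollectI conjI) (simp_all only:)
    from subsetD[OF equalityD1[OF eq] this]
    have "translate linf_alg \<phi> X = translate linf_alg (translate linf_alg \<phi> X) Y" by blast
    also have "\<dots> = translate linf_alg \<phi> (Y \<otimes>\<^bsub>bidual linf_alg\<^esub> X)"
      by (rule translate_translate[OF \<phi> in_bi(2) in_bi(1)])
    finally have "translate linf_alg \<phi> X (mult_op (\<lambda>x. 1)) =
        translate linf_alg \<phi> (Y \<otimes>\<^bsub>bidual linf_alg\<^esub> X) (mult_op (\<lambda>x. 1))" by (rule arg_cong)
    then show ?thesis unfolding translate_one[OF \<phi>] ..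
  qed
  have in_bi: "z \<in> linf_bidual" "z' \<in> linf_bidual" using z z' by (auto simp: projection_def)
  show ?thesis
  proof (rule extensionalityI)
    show "z \<in> extensional linf_dual" "z' \<in> extensional linf_dual"
      using in_bi linf_bidual_extensional by blast+
    fix \<phi> :: "(('k \<Rightarrow> complex) \<Rightarrow> ('k \<Rightarrow> complex)) \<Rightarrow> complex" assume \<phi>: "\<phi> \<in> linf_dual"
    have "z \<phi> = (z' \<otimes>\<^bsub>bidual linf_alg\<^esub> z) \<phi>" using absorb[OF z(1) z' \<phi> eq] ..
    also have "\<dots> = (z \<otimes>\<^bsub>bidual linf_alg\<^esub> z') \<phi>" using z(2) in_bi by (simp add: central_def)
    also have "\<dots> = z' \<phi>" by (rule absorb[OF z' z(1) \<phi> eq[symmetric]])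
    finally show "z \<phi> = z' \<phi>" .
  qed
qed

section \<open>The normal part and the singular part\<close>

definition point_eval :: "'k \<Rightarrow> (('k \<Rightarrow> complex) \<Rightarrow> ('k \<Rightarrow> complex)) \<Rightarrow> complex" where
  "point_eval x = (\<lambda>T\<in>linf. symbol T x)"

definition atomic_functional :: "('k \<Rightarrow> complex) \<Rightarrow> (('k \<Rightarrow> complex) \<Rightarrow> ('k \<Rightarrow> complex)) \<Rightarrow> complex" where
  "atomic_functional w = (\<lambda>T\<in>linf. \<Sum>\<^sub>\<infinity>x. symbol T x * w x)"

definition atomic_proj :: "((('k \<Rightarrow> complex) \<Rightarrow> ('k \<Rightarrow> complex)) \<Rightarrow> complex) \<Rightarrow> complex" where
  "atomic_proj = (\<lambda>\<phi>\<in>linf_dual. \<Sum>\<^sub>\<infinity>x. \<phi> (mult_op (point x)))"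

lemma point_eval_apply: "bounded (range g) \<Longrightarrow> point_eval x (mult_op g) = g x"
  by (simp add: point_eval_def)

lemma atomic_functional_apply:
  "bounded (range g) \<Longrightarrow> atomic_functional w (mult_op g) = (\<Sum>\<^sub>\<infinity>x. g x * w x)"
  by (simp add: atomic_functional_def)

lemma point_eval_closed: "point_eval x \<in> linf_dual"
  unfolding point_eval_def by (rule linf_dualI[where C = 1]) auto

lemma mult_abs_summable:
  fixes g w :: "'k \<Rightarrow> complex"
  assumes "bounded (range g)" "(\<lambda>x. cmod (w x)) summable_on A"
  shows "(\<lambda>x. cmod (g x * w x)) summable_on A"
proof -
  obtain K where K: "K \<ge> 0" "\<And>x. cmod (g x) \<le> K" using assms(1) bounded_rangeE by blast
  have "(\<lambda>x. K * cmod (w x)) summable_on A" by (intro summable_on_cmult_right assms)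
  then show ?thesis
    by (rule summable_on_le) (auto simp: norm_mult intro!: mult_right_mono K)
qed

lemma infsum_mult_bound:
  fixes g w :: "'k \<Rightarrow> complex"
  assumes "\<And>x. cmod (g x) \<le> K" "(\<lambda>x. cmod (w x)) summable_on UNIV"
  shows "cmod (\<Sum>\<^sub>\<infinity>x. g x * w x) \<le> K * (\<Sum>\<^sub>\<infinity>x. cmod (w x))"
proof -
  have "bounded (range g)" using assms(1) bounded_range_iff by blast
  then have s: "(\<lambda>x. cmod (g x * w x)) summable_on UNIV" by (rule mult_abs_summable[OF _ assms(2)])
  have "cmod (\<Sum>\<^sub>\<infinity>x. g x * w x) \<le> (\<Sum>\<^sub>\<infinity>x. cmod (g x * w x))" by (rule norm_infsum_bound[OF s])
  also have "\<dots> \<le> (\<Sum>\<^sub>\<infinity>x. K * cmod (w x))"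
    by (rule infsum_mono[OF s]) (auto simp: norm_mult intro!: mult_right_mono summable_on_cmult_right assms)
  also have "\<dots> = K * (\<Sum>\<^sub>\<infinity>x. cmod (w x))" by (rule infsum_cmult_right')
  finally show ?thesis .
qed

lemma atomic_functional_closed:
  assumes "(\<lambda>x. cmod (w x)) summable_on UNIV"
  shows "atomic_functional w \<in> linf_dual"
  unfolding atomic_functional_def
proof (rule linf_dualI[where C = "\<Sum>\<^sub>\<infinity>x. cmod (w x)"])
  fix g h :: "'a \<Rightarrow> complex" and c K
  have s: "(\<lambda>x. g x * w x) summable_on UNIV" if "bounded (range g)" for g
    by (rule abs_summable_summable[OF mult_abs_summable[OF that assms]])
  show "(\<Sum>\<^sub>\<infinity>x. (g x + h x) * w x) = (\<Sum>\<^sub>\<infinity>x. g x * w x) + (\<Sum>\<^sub>\<infinity>x. h x * w x)"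
    if "bounded (range g)" "bounded (range h)"
    unfolding distrib_right by (intro infsum_add s that)
  show "(\<Sum>\<^sub>\<infinity>x. c * g x * w x) = c * (\<Sum>\<^sub>\<infinity>x. g x * w x)"
    unfolding mult.assoc by (rule infsum_cmult_right')
  show "cmod (\<Sum>\<^sub>\<infinity>x. g x * w x) \<le> (\<Sum>\<^sub>\<infinity>x. cmod (w x)) * K" if "\<And>x. cmod (g x) \<le> K"
    using infsum_mult_bound[of g K, OF that assms] by (simp add: mult.commute)
qed

section \<open>Elements of the bidual evaluated on absolutely summable weights\<close>

lemma infsum_remove_finite:
  fixes f :: "'k \<Rightarrow> 'b :: banach"
  assumes "f summable_on UNIV" "finite F"
  shows "(\<Sum>\<^sub>\<infinity>x. f x) = (\<Sum>x\<in>F. f x) + (\<Sum>\<^sub>\<infinity>x. if x \<in> F then 0 else f x)"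
proof -
  have "(\<Sum>\<^sub>\<infinity>x. f x) = infsum f (F \<union> - F)" by simp
  also have "\<dots> = infsum f F + infsum f (- F)"
    by (rule infsum_Un_disjoint) (auto intro: summable_on_subset_banach[OF assms(1)])
  also have "infsum f (- F) = (\<Sum>\<^sub>\<infinity>x. if x \<in> F then 0 else f x)"
    by (rule infsum_cong_neutral) auto
  finally show ?thesis using assms(2) by simp
qed

lemma abs_summable_remove:
  fixes w :: "'k \<Rightarrow> complex"
  assumes "(\<lambda>x. cmod (w x)) summable_on UNIV"
  shows "(\<lambda>x. cmod (if x \<in> F then 0 else w x)) summable_on UNIV"
  using assms by (rule summable_on_le) auto

text \<open>Additivity of \<open>X\<close> handles only finitely many summands, so atoms are peeled
  off one at a time; the remaining tail is left to a norm estimate.\<close>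

lemma bidual_atomic_functional_split:
  fixes w :: "'k \<Rightarrow> complex"
  assumes X: "X \<in> linf_bidual" and w: "(\<lambda>x. cmod (w x)) summable_on UNIV" and "finite F"
  shows "X (atomic_functional w) = (\<Sum>x\<in>F. w x * X (point_eval x))
    + X (atomic_functional (\<lambda>x. if x \<in> F then 0 else w x))"
  using \<open>finite F\<close>
proof (induction F)
  case (insert a F)
  define v where "v = (\<lambda>x. if x \<in> F then 0 else w x)"
  define v' where "v' = (\<lambda>x. if x \<in> insert a F then 0 else w x)"
  have v: "(\<lambda>x. cmod (v x)) summable_on UNIV" and v': "(\<lambda>x. cmod (v' x)) summable_on UNIV"
    unfolding v_def v'_def by (intro abs_summable_remove w)+
  have "atomic_functional v = (\<lambda>T\<in>linf. (\<lambda>T\<in>linf. w a * point_eval a T) T + atomic_functional v' T)"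
    unfolding atomic_functional_def[of v]
  proof (rule restrict_ext)
    fix T :: "('k \<Rightarrow> complex) \<Rightarrow> ('k \<Rightarrow> complex)" assume T: "T \<in> linf"
    then obtain g where g: "bounded (range g)" "T = mult_op g" by (rule linfE)
    have "(\<Sum>\<^sub>\<infinity>x. g x * v x) = (\<Sum>x\<in>{a}. g x * v x) + (\<Sum>\<^sub>\<infinity>x. if x \<in> {a} then 0 else g x * v x)"
      by (rule infsum_remove_finite[OF abs_summable_summable[OF mult_abs_summable[OF g(1) v]]]) simp
    also have "(\<Sum>x\<in>{a}. g x * v x) = w a * g a"
      using insert.hyps by (simp add: v_def)
    also have "(\<lambda>x. if x \<in> {a} then 0 else g x * v x) = (\<lambda>x. g x * v' x)"
      by (auto simp: v_def v'_def)
    finally show "(\<Sum>\<^sub>\<infinity>x. symbol T x * v x) =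
        (\<lambda>T\<in>linf. w a * point_eval a T) T + atomic_functional v' T"
      using g by (simp add: point_eval_apply atomic_functional_apply)
  qed
  moreover have "(\<lambda>T\<in>linf. w a * point_eval a T) \<in> linf_dual"
    unfolding point_eval_def
    \<comment> \<open>Rewrites the functional as a map on functions composed with
      \<open>symbol\<close>, the shape expected by \<open>linf_dualI\<close>.\<close>
    by (rule subst[of "\<lambda>T\<in>linf. (\<lambda>g. w a * g a) (symbol T)" _ "\<lambda>\<phi>. \<phi> \<in> linf_dual"])
      (auto intro!: restrict_ext linf_dualI[where C = "cmod (w a)"] simp: distrib_left norm_mult mult_left_mono)
  ultimately have "X (atomic_functional v) = X (\<lambda>T\<in>linf. w a * point_eval a T) + X (atomic_functional v')"
    by (simp only: linf_bidual_add[OF X _ atomic_functional_closed[OF v']])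
  also have "X (\<lambda>T\<in>linf. w a * point_eval a T) = w a * X (point_eval a)"
    by (rule linf_bidual_smult[OF X point_eval_closed])
  finally have "X (atomic_functional v) = w a * X (point_eval a) + X (atomic_functional v')" .
  then show ?case using insert by (simp add: v_def v'_def)
qed simp

text \<open>An atomic functional is a norm limit of combinations of point evaluations.  This continuity is
  what makes \<open>atomic_proj\<close> central.\<close>

lemma bidual_atomic_functional:
  fixes w :: "'k \<Rightarrow> complex"
  assumes X: "X \<in> linf_bidual" and w: "(\<lambda>x. cmod (w x)) summable_on UNIV"
  shows "((\<lambda>x. w x * X (point_eval x)) has_sum X (atomic_functional w)) UNIV"
proof -
  obtain B where B: "B \<ge> 0" "\<And>\<phi> D. \<phi> \<in> linf_dual \<Longrightarrow>
    (\<And>g. (\<And>x. cmod (g x) \<le> 1) \<Longrightarrow> cmod (\<phi> (mult_op g)) \<le> D) \<Longrightarrow> cmod (X \<phi>) \<le> B * D"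
    using linf_bidual_bound[OF X] by blast
  let ?t = "\<Sum>\<^sub>\<infinity>x. cmod (w x)"
  have "((\<lambda>F. \<Sum>x\<in>F. cmod (w x)) \<longlongrightarrow> ?t) (finite_subsets_at_top UNIV)"
    by (rule infsum_tendsto[OF w])
  then have "((\<lambda>F. B * (?t - (\<Sum>x\<in>F. cmod (w x)))) \<longlongrightarrow> B * (?t - ?t)) (finite_subsets_at_top UNIV)"
    by (intro tendsto_intros)
  then have lim: "((\<lambda>F. B * (?t - (\<Sum>x\<in>F. cmod (w x)))) \<longlongrightarrow> 0) (finite_subsets_at_top UNIV)" by simp
  \<comment> \<open>The difference is \<open>X\<close> at the functional of the weight outside
    \<open>F\<close>, which is bounded on the unit ball by the tail of the sum of the moduli;
    \<open>B\<close> is a bound for \<open>X\<close>.\<close>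
  have "cmod (X (atomic_functional w) - (\<Sum>x\<in>F. w x * X (point_eval x))) \<le> B * (?t - (\<Sum>x\<in>F. cmod (w x)))"
    if F: "finite F" for F
  proof -
    define v where "v = (\<lambda>x. if x \<in> F then 0 else w x)"
    have v: "(\<lambda>x. cmod (v x)) summable_on UNIV"
      unfolding v_def by (intro abs_summable_remove w)
    have "?t = (\<Sum>x\<in>F. cmod (w x)) + (\<Sum>\<^sub>\<infinity>x. if x \<in> F then 0 else cmod (w x))"
      by (rule infsum_remove_finite[OF w F])
    also have "(\<lambda>x. if x \<in> F then 0 else cmod (w x)) = (\<lambda>x. cmod (v x))"
      by (auto simp: v_def)
    finally have t: "?t - (\<Sum>x\<in>F. cmod (w x)) = (\<Sum>\<^sub>\<infinity>x. cmod (v x))" by simp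
    have "cmod (X (atomic_functional v)) \<le> B * (\<Sum>\<^sub>\<infinity>x. cmod (v x))"
    proof (rule B(2)[OF atomic_functional_closed[OF v]])
      fix g :: "'k \<Rightarrow> complex" assume g: "\<And>x. cmod (g x) \<le> 1"
      then have "bounded (range g)" using bounded_range_iff by blast
      then show "cmod (atomic_functional v (mult_op g)) \<le> (\<Sum>\<^sub>\<infinity>x. cmod (v x))"
        using infsum_mult_bound[of g 1, OF g v] by (simp add: atomic_functional_apply)
    qed
    moreover have "X (atomic_functional w) - (\<Sum>x\<in>F. w x * X (point_eval x)) = X (atomic_functional v)"
      using bidual_atomic_functional_split[OF X w F] by (simp add: v_def)
    ultimately show ?thesis by (simp add: t)
  qed
  then have "\<forall>\<^sub>F F in finite_subsets_at_top UNIV.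
      cmod ((\<Sum>x\<in>F. w x * X (point_eval x)) - X (atomic_functional w)) \<le> B * (?t - (\<Sum>x\<in>F. cmod (w x)))"
    by (intro eventually_finite_subsets_at_top_weakI) (simp add: norm_minus_commute)
  from Lim_null_comparison[OF this lim] show ?thesis
    unfolding has_sum_def by (simp add: LIM_zero_iff)
qed

section \<open>The projection onto the atomic part\<close>

lemma cnj_sgn_mult: "cnj (sgn z) * z = complex_of_real (cmod z)"
proof (cases "z = 0")
  case False
  have "cnj (sgn z) * z = (z * cnj z) / complex_of_real (cmod z)" by (simp add: sgn_eq mult.commute)
  also have "\<dots> = complex_of_real (cmod z)"
    unfolding complex_norm_square[symmetric] using False by (simp add: power2_eq_square)
  finally show ?thesis .
qed simp

text \<open>Test \<open>\<phi>\<close> against the function supported on \<open>F\<close> whose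
  values are the conjugate phases of the values of \<open>\<phi>\<close> at the atoms: its modulus
  is at most 1, and \<open>\<phi>\<close> sends it to the sum of moduli. This yields both absolute
  summability over the atoms and contractivity of \<open>atomic_proj\<close>.\<close>

lemma sum_atoms_le:
  fixes \<phi> :: "(('k \<Rightarrow> complex) \<Rightarrow> ('k \<Rightarrow> complex)) \<Rightarrow> complex"
  assumes \<phi>: "\<phi> \<in> linf_dual" and D: "\<And>g. (\<And>x. cmod (g x) \<le> 1) \<Longrightarrow> cmod (\<phi> (mult_op g)) \<le> D"
    and F: "finite F"
  shows "(\<Sum>x\<in>F. cmod (\<phi> (mult_op (point x)))) \<le> D"
proof -
  let ?c = "\<lambda>x. \<phi> (mult_op (point x))"
  have "(\<Sum>x\<in>F. cnj (sgn (?c x)) * point x y) = (if y \<in> F then cnj (sgn (?c y)) else 0)" for y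
    using F by (simp add: point_def if_distrib[of "(*) _"] sum.delta cong: if_cong)
  then have "cmod (\<Sum>x\<in>F. cnj (sgn (?c x)) * point x y) \<le> 1" for y
    by (simp add: norm_sgn)
  from D[of "\<lambda>y. \<Sum>x\<in>F. cnj (sgn (?c x)) * point x y", OF this]
  have "cmod (\<Sum>x\<in>F. cnj (sgn (?c x)) * ?c x) \<le> D"
    by (simp add: linf_dual_sum[OF \<phi>])
  also have "(\<Sum>x\<in>F. cnj (sgn (?c x)) * ?c x) = complex_of_real (\<Sum>x\<in>F. cmod (?c x))"
    by (simp add: cnj_sgn_mult)
  also have "cmod \<dots> = (\<Sum>x\<in>F. cmod (?c x))"
    unfolding norm_of_real by (simp add: sum_nonneg)
  finally show ?thesis .
qed

lemma atoms_abs_summable: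
  assumes \<phi>: "\<phi> \<in> linf_dual"
  shows "(\<lambda>x. cmod (\<phi> (mult_op (point x)))) summable_on UNIV"
proof -
  obtain C where C: "C \<ge> 0" "\<And>g K. (\<And>x. cmod (g x) \<le> K) \<Longrightarrow> cmod (\<phi> (mult_op g)) \<le> C * K"
    using linf_dual_bound[OF assms(1)] by blast
  have "(\<Sum>x\<in>F. cmod (\<phi> (mult_op (point x)))) \<le> C" if "finite F" for F
    using sum_atoms_le[OF \<phi> _ that, of C] C(2)[where K = 1] by simp
  then show ?thesis
    by (intro nonneg_bdd_above_summable_on) (auto intro!: bdd_aboveI)
qed

lemma atomic_proj_apply: "\<phi> \<in> linf_dual \<Longrightarrow> atomic_proj \<phi> = (\<Sum>\<^sub>\<infinity>x. \<phi> (mult_op (point x)))"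
  by (simp add: atomic_proj_def)

lemma linf_dual_add_closed:
  assumes \<phi>: "\<phi> \<in> linf_dual" and \<psi>: "\<psi> \<in> linf_dual"
  shows "(\<lambda>T\<in>linf. \<phi> T + \<psi> T) \<in> linf_dual"
proof -
  obtain C where C: "\<And>g K. (\<And>x. cmod (g x) \<le> K) \<Longrightarrow> cmod (\<phi> (mult_op g)) \<le> C * K"
    using linf_dual_bound[OF \<phi>] by blast
  obtain C' where C': "\<And>g K. (\<And>x. cmod (g x) \<le> K) \<Longrightarrow> cmod (\<psi> (mult_op g)) \<le> C' * K"
    using linf_dual_bound[OF \<psi>] by blast
  have "cmod (\<phi> (mult_op g) + \<psi> (mult_op g)) \<le> (C + C') * K" if "\<And>x. cmod (g x) \<le> K" for g K
    using norm_triangle_ineq[of "\<phi> (mult_op g)" "\<psi> (mult_op g)"] C[of g K, OF that] C'[of g K, OF that]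
    by (simp add: distrib_right)
  then have "(\<lambda>T\<in>linf. (\<lambda>g. \<phi> (mult_op g) + \<psi> (mult_op g)) (symbol T)) \<in> linf_dual"
    using \<phi> \<psi> by (intro linf_dualI) (auto simp: linf_dual_add linf_dual_smult distrib_left)
  also have "(\<lambda>T\<in>linf. (\<lambda>g. \<phi> (mult_op g) + \<psi> (mult_op g)) (symbol T)) = (\<lambda>T\<in>linf. \<phi> T + \<psi> T)"
    by (rule restrict_ext) (auto elim: linfE)
  finally show ?thesis .
qed

text \<open>A scalar multiple is a shift by a constant function, so \<open>dshift_closed\<close>
  applies.\<close>

lemma linf_dual_smult_closed:
  assumes \<phi>: "\<phi> \<in> linf_dual"
  shows "(\<lambda>T\<in>linf. c * \<phi> T) \<in> linf_dual"
proof -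
  have "(\<lambda>T\<in>linf. c * \<phi> T) = dshift \<phi> (\<lambda>x. c)"
    unfolding dshift_def
  proof (rule restrict_ext)
    fix T :: "('a \<Rightarrow> complex) \<Rightarrow> ('a \<Rightarrow> complex)" assume "T \<in> linf"
    then obtain g where "bounded (range g)" "T = mult_op g" by (rule linfE)
    then show "c * \<phi> T = \<phi> (mult_op (\<lambda>x. symbol T x * c))"
      using linf_dual_smult[OF \<phi>, of g c] by (simp add: mult.commute)
  qed
  then show ?thesis using dshift_closed[OF \<phi>, of "\<lambda>x. c"] by simp
qed

lemma atomic_proj_le:
  fixes \<phi> :: "(('k \<Rightarrow> complex) \<Rightarrow> ('k \<Rightarrow> complex)) \<Rightarrow> complex"
  assumes \<phi>: "\<phi> \<in> linf_dual" and D: "\<And>g. (\<And>x. cmod (g x) \<le> 1) \<Longrightarrow> cmod (\<phi> (mult_op g)) \<le> D"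
  shows "cmod (atomic_proj \<phi>) \<le> D"
proof -
  have "cmod (atomic_proj \<phi>) \<le> (\<Sum>\<^sub>\<infinity>x. cmod (\<phi> (mult_op (point x))))"
    unfolding atomic_proj_apply[OF \<phi>] by (rule norm_infsum_bound[OF atoms_abs_summable[OF \<phi>]])
  also have "\<dots> \<le> D"
    by (rule infsum_le_finite_sums[OF atoms_abs_summable[OF \<phi>]]) (use sum_atoms_le[OF \<phi> D] in blast)
  finally show ?thesis .
qed

lemma atomic_proj_closed: "atomic_proj \<in> linf_bidual"
proof (rule linf_bidualI)
  fix \<phi> \<psi> :: "(('a \<Rightarrow> complex) \<Rightarrow> ('a \<Rightarrow> complex)) \<Rightarrow> complex" and c D
  assume \<phi>: "\<phi> \<in> linf_dual"
  have s: "(\<lambda>x. \<phi> (mult_op (point x))) summable_on UNIV" if "\<phi> \<in> linf_dual" for \<phi>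
    by (rule abs_summable_summable[OF atoms_abs_summable[OF that]])
  show "atomic_proj (\<lambda>T\<in>linf. \<phi> T + \<psi> T) = atomic_proj \<phi> + atomic_proj \<psi>" if \<psi>: "\<psi> \<in> linf_dual"
    using \<phi> \<psi> linf_dual_add_closed[OF \<phi> \<psi>] by (simp add: atomic_proj_apply infsum_add s)
  show "atomic_proj (\<lambda>T\<in>linf. c * \<phi> T) = c * atomic_proj \<phi>"
    using \<phi> linf_dual_smult_closed[OF \<phi>, of c] by (simp add: atomic_proj_apply infsum_cmult_right')
  show "cmod (atomic_proj \<phi>) \<le> D" if "\<And>g. (\<And>x. cmod (g x) \<le> 1) \<Longrightarrow> cmod (\<phi> (mult_op g)) \<le> D"
    by (rule atomic_proj_le[OF \<phi> that])
qed (simp add: atomic_proj_def)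

text \<open>\<open>point x\<close> is a minimal projection: a function times \<open>point x\<close>
  is a scalar multiple of it. Hence cutting \<open>\<phi>\<close> down to one atom leaves a multiple
  of the evaluation there.\<close>

lemma dshift_point:
  assumes "\<phi> \<in> linf_dual"
  shows "dshift \<phi> (point x) = (\<lambda>T\<in>linf. \<phi> (mult_op (point x)) * point_eval x T)"
  unfolding dshift_def
proof (rule restrict_ext)
  fix T :: "('a \<Rightarrow> complex) \<Rightarrow> ('a \<Rightarrow> complex)" assume "T \<in> linf"
  then obtain g where g: "bounded (range g)" "T = mult_op g" by (rule linfE)
  have "(\<lambda>y. g y * point x y) = (\<lambda>y. g x * point x y)"
    by (auto simp: point_def)
  then show "\<phi> (mult_op (\<lambda>y. symbol T y * point x y)) = \<phi> (mult_op (point x)) * point_eval x T"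
    using g linf_dual_smult[OF assms, of "point x" "g x"] by (simp add: point_eval_apply mult.commute)
qed

text \<open>Translation by \<open>atomic_proj\<close> forgets everything about \<open>\<phi>\<close>
  except its values at the atoms, which become the weight of an atomic functional. Idempotence,
  centrality and the description of the predual all use this formula.\<close>

lemma translate_atomic_proj:
  assumes "\<phi> \<in> linf_dual"
  shows "translate linf_alg \<phi> atomic_proj = atomic_functional (\<lambda>x. \<phi> (mult_op (point x)))"
proof (rule extensionalityI[OF translate_extensional])
  fix T :: "('a \<Rightarrow> complex) \<Rightarrow> ('a \<Rightarrow> complex)" assume "T \<in> linf"
  then obtain g where g: "bounded (range g)" "T = mult_op g" by (rule linfE)
  have "\<phi> (mult_op (\<lambda>y. point x y * g y)) = g x * \<phi> (mult_op (point x))" for x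
  proof -
    have "(\<lambda>y. point x y * g y) = (\<lambda>y. g x * point x y)" by (auto simp: point_def)
    then show ?thesis using linf_dual_smult[OF assms, of "point x" "g x"] by simp
  qed
  then show "translate linf_alg \<phi> atomic_proj T = atomic_functional (\<lambda>x. \<phi> (mult_op (point x))) T"
    using g assms by (simp add: translate_apply atomic_proj_apply dshift_closed dshift_apply atomic_functional_apply)
qed (simp add: atomic_functional_def)

lemma atomic_functional_point:
  "atomic_functional w (mult_op (point x)) = w x"
  by (simp add: atomic_functional_apply infsum_point_mult)

lemma atomic_proj_atomic_functional:
  assumes "(\<lambda>x. cmod (w x)) summable_on UNIV"
  shows "atomic_proj (atomic_functional w) = (\<Sum>\<^sub>\<infinity>x. w x)"
  by (simp add: atomic_proj_apply atomic_functional_closed[OF assms] atomic_functional_point)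

lemma projection_atomic_proj:
  "projection (bidual linf_alg) (atomic_proj :: ((('k \<Rightarrow> complex) \<Rightarrow> ('k \<Rightarrow> complex)) \<Rightarrow> complex) \<Rightarrow> complex)"
  (is "projection _ ?z")
  unfolding projection_def
proof (intro conjI)
  show "?z \<in> carrier (bidual linf_alg)" by (simp add: atomic_proj_closed)
  show "?z \<otimes>\<^bsub>bidual linf_alg\<^esub> ?z = ?z"
  proof (rule extensionalityI[OF bidual_mult_extensional linf_bidual_extensional[OF atomic_proj_closed]])
    fix \<phi> :: "(('k \<Rightarrow> complex) \<Rightarrow> ('k \<Rightarrow> complex)) \<Rightarrow> complex" assume \<phi>: "\<phi> \<in> linf_dual"
    then show "(atomic_proj \<otimes>\<^bsub>bidual linf_alg\<^esub> atomic_proj) \<phi> = atomic_proj \<phi>"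
      by (simp add: bidual_mult_apply translate_atomic_proj atomic_proj_atomic_functional
          atoms_abs_summable atomic_proj_apply)
  qed
  show "star (bidual linf_alg) ?z = ?z"
  proof (rule extensionalityI[OF _ linf_bidual_extensional[OF atomic_proj_closed]])
    fix \<phi> :: "(('k \<Rightarrow> complex) \<Rightarrow> ('k \<Rightarrow> complex)) \<Rightarrow> complex" assume \<phi>: "\<phi> \<in> linf_dual"
    have eq: "(\<lambda>T\<in>linf. cnj (\<phi> (star linf_alg T))) = (\<lambda>T\<in>linf. (\<lambda>g. cnj (\<phi> (mult_op (\<lambda>x. cnj (g x))))) (symbol T))"
    proof (rule restrict_ext)
      fix T :: "('k \<Rightarrow> complex) \<Rightarrow> ('k \<Rightarrow> complex)" assume "T \<in> linf"
      then obtain g where "bounded (range g)" "T = mult_op g" by (rule linfE)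
      then show "cnj (\<phi> (star linf_alg T)) = (\<lambda>g. cnj (\<phi> (mult_op (\<lambda>x. cnj (g x))))) (symbol T)"
        by simp
    qed
    obtain C where C: "C \<ge> 0" "\<And>g K. (\<And>x. cmod (g x) \<le> K) \<Longrightarrow> cmod (\<phi> (mult_op g)) \<le> C * K"
      using linf_dual_bound[OF \<phi>] by blast
    \<comment> \<open>\<open>atomic_proj\<close> is restricted to the dual, so it can be evaluated
      at the adjoint functional only once that functional is known to be bounded.\<close>
    have star_closed: "(\<lambda>T\<in>linf. (\<lambda>g. cnj (\<phi> (mult_op (\<lambda>x. cnj (g x))))) (symbol T)) \<in> linf_dual"
    proof (rule linf_dualI[where C = C])
      fix g h :: "'k \<Rightarrow> complex" and c K
      show "cnj (\<phi> (mult_op (\<lambda>x. cnj (g x + h x)))) =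
          cnj (\<phi> (mult_op (\<lambda>x. cnj (g x)))) + cnj (\<phi> (mult_op (\<lambda>x. cnj (h x))))"
        if "bounded (range g)" "bounded (range h)"
        by (simp only: complex_cnj_add
            linf_dual_add[OF \<phi> bounded_range_intros(5)[OF that(1)] bounded_range_intros(5)[OF that(2)]])
      show "cnj (\<phi> (mult_op (\<lambda>x. cnj (c * g x)))) = c * cnj (\<phi> (mult_op (\<lambda>x. cnj (g x))))"
        if "bounded (range g)"
        using linf_dual_smult[OF \<phi>, of "\<lambda>x. cnj (g x)" "cnj c"] that by simp
      show "cmod (cnj (\<phi> (mult_op (\<lambda>x. cnj (g x))))) \<le> C * K" if "\<And>x. cmod (g x) \<le> K"
        using C(2)[of "\<lambda>x. cnj (g x)" K] that by simp
    qed
    \<comment> \<open>Atoms are self-adjoint: the adjoint functional takes conjugate values at them,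
      and the outer conjugation of the involution undoes this.\<close>
    have "cnj (point x y) = point x y" for x y :: 'k by (simp add: point_def)
    then show "star (bidual linf_alg) atomic_proj \<phi> = atomic_proj \<phi>"
      using \<phi> eq star_closed by (simp add: bidual_def atomic_proj_apply)
  qed (simp add: bidual_def)
qed

text \<open>Both products are evaluated at \<open>\<phi>\<close>: one is the sum over the atoms of
  \<open>X\<close> at \<open>\<phi>\<close> cut down to an atom, the other is \<open>X\<close> at
  the atomic part of \<open>\<phi>\<close>. They agree because
  \<open>bidual_atomic_functional\<close> exchanges \<open>X\<close> with the sum.\<close>

lemma central_atomic_proj:
  "central (bidual linf_alg) (atomic_proj :: ((('k \<Rightarrow> complex) \<Rightarrow> ('k \<Rightarrow> complex)) \<Rightarrow> complex) \<Rightarrow> complex)"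
  (is "central _ ?z")
  unfolding central_def
proof (intro conjI ballI)
  show "?z \<in> carrier (bidual linf_alg)" by (simp add: atomic_proj_closed)
  fix X :: "((('k \<Rightarrow> complex) \<Rightarrow> ('k \<Rightarrow> complex)) \<Rightarrow> complex) \<Rightarrow> complex"
  assume "X \<in> carrier (bidual linf_alg)"
  then have X: "X \<in> linf_bidual" by simp
  show "atomic_proj \<otimes>\<^bsub>bidual linf_alg\<^esub> X = X \<otimes>\<^bsub>bidual linf_alg\<^esub> atomic_proj"
  proof (rule extensionalityI[OF bidual_mult_extensional bidual_mult_extensional])
    fix \<phi> :: "(('k \<Rightarrow> complex) \<Rightarrow> ('k \<Rightarrow> complex)) \<Rightarrow> complex" assume \<phi>: "\<phi> \<in> linf_dual"
    have "(atomic_proj \<otimes>\<^bsub>bidual linf_alg\<^esub> X) \<phi> = (\<Sum>\<^sub>\<infinity>x. X (dshift \<phi> (point x)))"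
      using \<phi> X by (simp add: bidual_mult_apply atomic_proj_apply translate_closed translate_apply)
    also have "\<dots> = (\<Sum>\<^sub>\<infinity>x. \<phi> (mult_op (point x)) * X (point_eval x))"
      using \<phi> X by (simp add: dshift_point linf_bidual_smult point_eval_closed)
    also have "\<dots> = X (atomic_functional (\<lambda>x. \<phi> (mult_op (point x))))"
      by (rule infsumI[OF bidual_atomic_functional[OF X atoms_abs_summable[OF \<phi>]]])
    also have "\<dots> = (X \<otimes>\<^bsub>bidual linf_alg\<^esub> atomic_proj) \<phi>"
      using \<phi> by (simp add: bidual_mult_apply translate_atomic_proj)
    finally show "(atomic_proj \<otimes>\<^bsub>bidual linf_alg\<^esub> X) \<phi> = (X \<otimes>\<^bsub>bidual linf_alg\<^esub> atomic_proj) \<phi>" .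
  qed
qed

section \<open>The sigma-weak topology and the predual\<close>

lemma topspace_sigma_weak:
  "topspace (sigma_weak_topology ell2 linf) = (linf :: (('k \<Rightarrow> complex) \<Rightarrow> ('k \<Rightarrow> complex)) set)"
proof
  \<comment> \<open>A generated topology lives on the union of its subbasis. Zero sequences with
    \<open>U = UNIV\<close> show that this union is all of \<open>linf\<close>.\<close>
  have "square_summable ell2 (\<lambda>n x. 0)"
    by (simp add: square_summable_def ell2_zero_closed hnorm_ell2)
  then have "linf \<in> {{T \<in> linf. (\<Sum>n. hinner ell2 (T (\<xi> n)) (\<eta> n)) \<in> U} | \<xi> \<eta> U.
        square_summable ell2 \<xi> \<and> square_summable ell2 \<eta> \<and> open U}"
    by (intro CollectI exI[of _ "\<lambda>n x. 0"] exI[of _ UNIV]) (auto simp del: ell2_simps)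
  then show "linf \<subseteq> topspace (sigma_weak_topology ell2 (linf :: (('k \<Rightarrow> complex) \<Rightarrow> ('k \<Rightarrow> complex)) set))"
    unfolding sigma_weak_topology_def topology_generated_by_topspace by (rule Union_upper)
qed (auto simp: sigma_weak_topology_def)

text \<open>One pair of vectors represents the functional, placed at index 0 of otherwise zero
  sequences. It is thus one of the functionals that generate the topology.\<close>

lemma atomic_functional_in_predual:
  fixes w :: "'k \<Rightarrow> complex"
  assumes "(\<lambda>x. cmod (w x)) summable_on UNIV"
  shows "atomic_functional w \<in> predual ell2 linf"
  unfolding predual_def
proof (intro CollectI conjI)
  show "atomic_functional w \<in> carrier (dual linf_alg)"
    using atomic_functional_closed[OF assms] by simp
  \<comment> \<open>The weight \<open>w\<close> is split into two factors of modulus \<open>sqrt \<bar>w\<bar>\<close>; the quotient is \<open>0\<close> where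
    \<open>w\<close> vanishes.\<close>
  define \<xi> :: "nat \<Rightarrow> 'k \<Rightarrow> complex" where
    "\<xi> n = (\<lambda>x. if n = 0 then w x / complex_of_real (sqrt (cmod (w x))) else 0)" for n
  define \<eta> :: "nat \<Rightarrow> 'k \<Rightarrow> complex" where
    "\<eta> n = (\<lambda>x. if n = 0 then complex_of_real (sqrt (cmod (w x))) else 0)" for n
  have sq: "(cmod (\<xi> 0 x))\<^sup>2 = cmod (w x)" "(cmod (\<eta> 0 x))\<^sup>2 = cmod (w x)" for x
    by (auto simp: \<xi>_def \<eta>_def norm_divide power_divide power2_eq_square)
  have \<xi>_in: "\<xi> n \<in> carrier ell2" and \<eta>_in: "\<eta> n \<in> carrier ell2" for n
  proof -
    have "\<xi> 0 \<in> carrier ell2" "\<eta> 0 \<in> carrier ell2" using assms by (simp_all add: in_ell2_iff sq)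
    moreover have "\<xi> n = (\<lambda>x. 0)" "\<eta> n = (\<lambda>x. 0)" if "n \<noteq> 0" using that by (simp_all add: \<xi>_def \<eta>_def)
    ultimately show "\<xi> n \<in> carrier ell2" "\<eta> n \<in> carrier ell2"
      using ell2_zero_closed by (cases "n = 0"; simp)+
  qed
  have "summable (\<lambda>n. (hnorm ell2 (\<xi> n))\<^sup>2)" "summable (\<lambda>n. (hnorm ell2 (\<eta> n))\<^sup>2)"
    by (rule summable_finite[of "{0}"]; simp add: \<xi>_def \<eta>_def hnorm_ell2)+
  then have "square_summable ell2 \<xi>" "square_summable ell2 \<eta>"
    using \<xi>_in \<eta>_in by (auto simp: square_summable_def)
  have val: "(\<Sum>n. hinner ell2 (T (\<xi> n)) (\<eta> n)) = atomic_functional w T" if T: "T \<in> linf" for T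
  proof -
    obtain g where g: "bounded (range g)" "T = mult_op g" using T by (rule linfE)
    have "(\<Sum>n. hinner ell2 (T (\<xi> n)) (\<eta> n)) = (\<Sum>n\<in>{0}. hinner ell2 (T (\<xi> n)) (\<eta> n))"
      by (rule suminf_finite) (auto simp: \<eta>_def)
    also have "\<dots> = (\<Sum>\<^sub>\<infinity>x. g x * (\<xi> 0 x * cnj (\<eta> 0 x)))"
      using g \<xi>_in by (simp add: mult_op_apply mult.assoc)
    also have "(\<lambda>x. \<xi> 0 x * cnj (\<eta> 0 x)) = w"
      by (auto simp: \<xi>_def \<eta>_def)
    finally show ?thesis using g by (simp add: atomic_functional_apply)
  qed
  show "continuous_map (sigma_weak_topology ell2 linf) euclidean (atomic_functional w)"
    unfolding continuous_map_def topspace_sigma_weak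
  proof (intro conjI allI impI)
    fix U :: "complex set" assume "openin euclidean U"
    then have "open U" by simp
    have "{T \<in> linf. atomic_functional w T \<in> U} = {T \<in> linf. (\<Sum>n. hinner ell2 (T (\<xi> n)) (\<eta> n)) \<in> U}"
      using val by auto
    then show "openin (sigma_weak_topology ell2 linf) {T \<in> linf. atomic_functional w T \<in> U}"
      unfolding sigma_weak_topology_def
      using \<open>open U\<close> \<open>square_summable ell2 \<xi>\<close> \<open>square_summable ell2 \<eta>\<close>
      by (intro topology_generated_by_Basis) blast
  qed auto
qed

lemma square_summable_prod:
  fixes \<xi> :: "nat \<Rightarrow> 'k \<Rightarrow> complex"
  assumes "square_summable ell2 \<xi>"
  shows "(\<lambda>(n, x). (cmod (\<xi> n x))\<^sup>2) summable_on UNIV"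
proof -
  have "(\<lambda>(n, x). (cmod (\<xi> n x))\<^sup>2) summable_on (UNIV \<times> UNIV)"
  proof (rule summable_on_SigmaI)
    show "((\<lambda>x. case (n, x) of (n, x) \<Rightarrow> (cmod (\<xi> n x))\<^sup>2) has_sum (hnorm ell2 (\<xi> n))\<^sup>2) UNIV" for n
    proof -
      have "\<xi> n \<in> carrier ell2" using assms by (auto simp: square_summable_def)
      then show ?thesis by (simp add: in_ell2_iff hnorm_ell2_sq)
    qed
    show "(\<lambda>n. (hnorm ell2 (\<xi> n))\<^sup>2) summable_on UNIV"
      using assms by (simp add: summable_on_UNIV_nonneg_real_iff square_summable_def)
  qed auto
  then show ?thesis by simp
qed

text \<open>The weight at \<open>x\<close> is the sum over \<open>n\<close> of
  \<open>\<xi> n x * cnj (\<eta> n x)\<close>. This double family is dominated by the sum of the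
  squares, hence absolutely summable, and the two summations may be exchanged.\<close>

lemma sigma_weak_functional:
  fixes \<xi> \<eta> :: "nat \<Rightarrow> 'k \<Rightarrow> complex"
  assumes \<xi>: "square_summable ell2 \<xi>" and \<eta>: "square_summable ell2 \<eta>"
  obtains w :: "'k \<Rightarrow> complex" where "(\<lambda>x. cmod (w x)) summable_on UNIV"
    and "\<And>g. bounded (range g) \<Longrightarrow> (\<Sum>n. hinner ell2 (mult_op g (\<xi> n)) (\<eta> n)) = (\<Sum>\<^sub>\<infinity>x. g x * w x)"
proof -
  define a where "a n x = \<xi> n x * cnj (\<eta> n x)" for n x
  define w where "w x = (\<Sum>\<^sub>\<infinity>n. a n x)" for x
  have "(\<lambda>p. (case p of (n, x) \<Rightarrow> (cmod (\<xi> n x))\<^sup>2) + (case p of (n, x) \<Rightarrow> (cmod (\<eta> n x))\<^sup>2)) summable_on UNIV"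
    by (intro summable_on_add square_summable_prod \<xi> \<eta>)
  then have a: "(\<lambda>(n, x). cmod (a n x)) summable_on UNIV"
    by (rule summable_on_le) (auto simp: a_def norm_mult mult_le_sum_sq)
  then have a': "(\<lambda>(x, n). cmod (a n x)) summable_on UNIV \<times> UNIV"
    using summable_on_swap[of "\<lambda>(n, x). cmod (a n x)" UNIV UNIV] by simp
  show thesis
  proof (rule that[of w])
    have "(\<lambda>x. \<Sum>\<^sub>\<infinity>n. cmod (a n x)) summable_on UNIV"
      using summable_on_Sigma_banach[OF a'] by simp
    then show "(\<lambda>x. cmod (w x)) summable_on UNIV"
    proof (rule summable_on_le)
      fix x
      have "(\<lambda>n. cmod (a n x)) summable_on UNIV"
        using summable_on_SigmaD1[OF a', of x] by simp
      then show "cmod (w x) \<le> (\<Sum>\<^sub>\<infinity>n. cmod (a n x))"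
        unfolding w_def by (rule norm_infsum_bound)
    qed simp
    fix g :: "'k \<Rightarrow> complex" assume g: "bounded (range g)"
    obtain K where K: "K \<ge> 0" "\<And>x. cmod (g x) \<le> K" using bounded_rangeE[OF g] by blast
    have "(\<lambda>p. K * (case p of (n, x) \<Rightarrow> cmod (a n x))) summable_on UNIV"
      by (intro summable_on_cmult_right a)
    then have "(\<lambda>p. cmod (case p of (n, x) \<Rightarrow> g x * a n x)) summable_on UNIV"
      by (rule summable_on_le) (auto simp: norm_mult intro!: mult_right_mono K)
    then have s: "(\<lambda>(n, x). g x * a n x) summable_on UNIV \<times> UNIV"
      by (simp add: abs_summable_summable)
    have \<xi>_in: "\<xi> n \<in> carrier ell2" for n using \<xi> by (auto simp: square_summable_def)
    have "hinner ell2 (mult_op g (\<xi> n)) (\<eta> n) = (\<Sum>\<^sub>\<infinity>x. g x * a n x)" for n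
      using \<xi>_in by (simp add: mult_op_apply a_def mult.assoc)
    then have "(\<Sum>n. hinner ell2 (mult_op g (\<xi> n)) (\<eta> n)) = (\<Sum>n. \<Sum>\<^sub>\<infinity>x. g x * a n x)" by simp
    also have "\<dots> = (\<Sum>\<^sub>\<infinity>n. \<Sum>\<^sub>\<infinity>x. g x * a n x)"
      using has_sum_imp_sums[OF has_sum_infsum[OF summable_on_Sigma_banach[OF s]]] by (rule sums_unique[symmetric])
    also have "\<dots> = (\<Sum>\<^sub>\<infinity>x. \<Sum>\<^sub>\<infinity>n. g x * a n x)"
      by (rule infsum_swap_banach[OF s])
    also have "\<dots> = (\<Sum>\<^sub>\<infinity>x. g x * w x)"
      by (simp add: w_def infsum_cmult_right')
    finally show "(\<Sum>n. hinner ell2 (mult_op g (\<xi> n)) (\<eta> n)) = (\<Sum>\<^sub>\<infinity>x. g x * w x)" .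
  qed
qed

text \<open>Each generating functional has an absolutely summable weight, so its values at the
  truncations are the finite partial sums of a convergent sum. Induction over the generation of open
  sets carries this from subbasic sets to all neighbourhoods.\<close>

lemma finite_truncation_sigma_weak:
  fixes g :: "'k \<Rightarrow> complex"
  assumes g: "bounded (range g)"
  shows "limitin (sigma_weak_topology ell2 linf) (\<lambda>F. mult_op (\<lambda>x. \<Sum>y\<in>F. g y * point y x)) (mult_op g)
    (finite_subsets_at_top UNIV)"
  unfolding limitin_def topspace_sigma_weak
proof (intro conjI allI impI; (elim conjE)?)
  show "mult_op g \<in> linf" using g by simp
  fix W assume "openin (sigma_weak_topology ell2 linf) W" and "mult_op g \<in> W"
  then have "generate_topology_on {{T \<in> linf. (\<Sum>n. hinner ell2 (T (\<xi> n)) (\<eta> n)) \<in> U} | \<xi> \<eta> U.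
        square_summable ell2 \<xi> \<and> square_summable ell2 \<eta> \<and> open U} W"
    by (simp only: sigma_weak_topology_def openin_topology_generated_by_iff)
  then show "\<forall>\<^sub>F F in finite_subsets_at_top UNIV. mult_op (\<lambda>x. \<Sum>y\<in>F. g y * point y x) \<in> W"
    using \<open>mult_op g \<in> W\<close>
  proof induction
    case (Int a b)
    then show ?case by (auto intro: eventually_conj)
  next
    case (UN \<U>)
    then obtain k where k: "k \<in> \<U>" "mult_op g \<in> k" by blast
    from UN.IH[OF this] show ?case by eventually_elim (use k in blast)
  next
    case (Basis W)
    then obtain \<xi> \<eta> :: "nat \<Rightarrow> 'k \<Rightarrow> complex" and U where
      W: "W = {T \<in> linf. (\<Sum>n. hinner ell2 (T (\<xi> n)) (\<eta> n)) \<in> U}"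
      and "square_summable ell2 \<xi>" "square_summable ell2 \<eta>" "open U" by blast
    obtain w :: "'k \<Rightarrow> complex" where w: "(\<lambda>x. cmod (w x)) summable_on UNIV"
      and val: "\<And>g. bounded (range g) \<Longrightarrow> (\<Sum>n. hinner ell2 (mult_op g (\<xi> n)) (\<eta> n)) = (\<Sum>\<^sub>\<infinity>x. g x * w x)"
      using sigma_weak_functional[OF \<open>square_summable ell2 \<xi>\<close> \<open>square_summable ell2 \<eta>\<close>] by blast
    have in_U: "(\<Sum>\<^sub>\<infinity>x. g x * w x) \<in> U"
      using Basis.prems val[OF g] unfolding W by simp
    have "((\<lambda>F. \<Sum>x\<in>F. g x * w x) \<longlongrightarrow> (\<Sum>\<^sub>\<infinity>x. g x * w x)) (finite_subsets_at_top UNIV)"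
      by (intro infsum_tendsto abs_summable_summable[OF mult_abs_summable[OF g w]])
    from topological_tendstoD[OF this \<open>open U\<close> in_U]
    have "\<forall>\<^sub>F F in finite_subsets_at_top UNIV. (\<Sum>x\<in>F. g x * w x) \<in> U" .
    moreover have "\<forall>\<^sub>F F in finite_subsets_at_top UNIV. finite (F :: 'k set)"
      by (rule eventually_finite_subsets_at_top_weakI)
    ultimately show ?case
    proof eventually_elim
      case (elim F)
      have bd: "bounded (range (\<lambda>x. \<Sum>y\<in>F. g y * point y x))" by simp
      have "(\<Sum>\<^sub>\<infinity>x. (\<Sum>y\<in>F. g y * point y x) * w x) = (\<Sum>\<^sub>\<infinity>x\<in>F. g x * w x)"
        using elim(2) by (intro infsum_cong_neutral)
          (auto simp: point_def if_distrib[of "(*) _"] sum.delta' cong: if_cong)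
      then show ?case
        using elim bd val[OF bd] by (simp add: W)
    qed
  qed simp
qed

text \<open>A continuous functional is the limit of its values at finite truncations, so it is the
  sum over the atoms and coincides with its atomic part. Conversely, a functional fixed by the
  translation has an absolutely summable weight.\<close>

lemma predual_linf:
  "predual ell2 linf = {\<phi> \<in> carrier (dual linf_alg). \<phi> = translate linf_alg \<phi> (atomic_proj ::
    ((('k \<Rightarrow> complex) \<Rightarrow> ('k \<Rightarrow> complex)) \<Rightarrow> complex) \<Rightarrow> complex)}"
proof (intro equalityI subsetI)
  fix \<phi> :: "(('k \<Rightarrow> complex) \<Rightarrow> ('k \<Rightarrow> complex)) \<Rightarrow> complex"
  assume "\<phi> \<in> {\<phi> \<in> carrier (dual linf_alg). \<phi> = translate linf_alg \<phi> atomic_proj}"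
  then have \<phi>: "\<phi> \<in> linf_dual" and "\<phi> = translate linf_alg \<phi> atomic_proj" by auto
  then have "\<phi> = atomic_functional (\<lambda>x. \<phi> (mult_op (point x)))"
    using translate_atomic_proj by metis
  then show "\<phi> \<in> predual ell2 linf"
    using atomic_functional_in_predual[OF atoms_abs_summable[OF \<phi>]] by metis
next
  fix \<phi> :: "(('k \<Rightarrow> complex) \<Rightarrow> ('k \<Rightarrow> complex)) \<Rightarrow> complex"
  assume "\<phi> \<in> predual ell2 linf"
  then have \<phi>: "\<phi> \<in> linf_dual" and cont: "continuous_map (sigma_weak_topology ell2 linf) euclidean \<phi>"
    by (auto simp: predual_def)
  have "\<phi> = atomic_functional (\<lambda>x. \<phi> (mult_op (point x)))"
  proof (rule linf_dual_eqI[OF \<phi> atomic_functional_closed[OF atoms_abs_summable[OF \<phi>]]])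
    fix g :: "'k \<Rightarrow> complex" assume g: "bounded (range g)"
    have "((\<lambda>F. \<phi> (mult_op (\<lambda>x. \<Sum>y\<in>F. g y * point y x))) \<longlongrightarrow> \<phi> (mult_op g)) (finite_subsets_at_top UNIV)"
      using continuous_map_limit[OF cont finite_truncation_sigma_weak[OF g]] by (simp add: o_def)
    then have "((\<lambda>x. g x * \<phi> (mult_op (point x))) has_sum \<phi> (mult_op g)) UNIV"
      unfolding has_sum_def by (simp add: linf_dual_sum[OF \<phi>])
    then show "\<phi> (mult_op g) = atomic_functional (\<lambda>x. \<phi> (mult_op (point x))) (mult_op g)"
      using g by (simp add: atomic_functional_apply infsumI)
  qed
  then show "\<phi> \<in> {\<phi> \<in> carrier (dual linf_alg). \<phi> = translate linf_alg \<phi> atomic_proj}"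
    using \<phi> translate_atomic_proj[OF \<phi>] by simp
qed

section \<open>Identification of the normal and the singular part projection\<close>

lemma normal_part_proj_linf: "normal_part_proj ell2 linf = atomic_proj"
  unfolding normal_part_proj_def
proof (rule the_equality)
  show "projection (bidual linf_alg) atomic_proj \<and> central (bidual linf_alg) atomic_proj \<and>
    predual ell2 linf = {\<phi> \<in> carrier (dual linf_alg). \<phi> = translate linf_alg \<phi> atomic_proj}"
    using projection_atomic_proj central_atomic_proj predual_linf by blast
next
  fix z :: "((('k \<Rightarrow> complex) \<Rightarrow> ('k \<Rightarrow> complex)) \<Rightarrow> complex) \<Rightarrow> complex"
  assume z: "projection (bidual linf_alg) z \<and> central (bidual linf_alg) z \<and>
    predual ell2 linf = {\<phi> \<in> carrier (dual linf_alg). \<phi> = translate linf_alg \<phi> z}"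
  show "z = atomic_proj"
  proof (rule central_projection_unique)
    show "{\<phi> \<in> linf_dual. \<phi> = translate linf_alg \<phi> z} = {\<phi> \<in> linf_dual. \<phi> = translate linf_alg \<phi> atomic_proj}"
      using trans[OF z[THEN conjunct2, THEN conjunct2, symmetric] predual_linf]
      by (simp only: dual_simps(1))
  qed (use z projection_atomic_proj in blast)+
qed

text \<open>Subtraction hides an additive inverse, again a definite description over the carrier.
  The pointwise negative must therefore be shown to lie in the bidual and to be the only inverse
  there.\<close>

lemma singular_part_proj_linf:
  "singular_part_proj ell2 linf =
    (\<lambda>\<phi>\<in>linf_dual. \<phi> (mult_op (\<lambda>x::'k. 1)) - atomic_proj \<phi>)"
proof -
  let ?z = "atomic_proj :: ((('k \<Rightarrow> complex) \<Rightarrow> ('k \<Rightarrow> complex)) \<Rightarrow> complex) \<Rightarrow> complex"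
  have neg: "(\<lambda>\<phi>\<in>linf_dual. - ?z \<phi>) \<in> linf_bidual"
  proof (rule linf_bidualI)
    fix \<phi> \<psi> :: "(('k \<Rightarrow> complex) \<Rightarrow> ('k \<Rightarrow> complex)) \<Rightarrow> complex" and c D
    assume \<phi>: "\<phi> \<in> linf_dual"
    let ?n = "\<lambda>\<phi>\<in>linf_dual. - ?z \<phi>"
    show "?n (\<lambda>T\<in>linf. \<phi> T + \<psi> T) = ?n \<phi> + ?n \<psi>" if \<psi>: "\<psi> \<in> linf_dual"
      using \<phi> \<psi> linf_dual_add_closed[OF \<phi> \<psi>] linf_bidual_add[OF atomic_proj_closed \<phi> \<psi>] by simp
    show "?n (\<lambda>T\<in>linf. c * \<phi> T) = c * ?n \<phi>"
      using \<phi> linf_dual_smult_closed[OF \<phi>] linf_bidual_smult[OF atomic_proj_closed \<phi>] by simp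
    assume D: "\<And>g. (\<And>x. cmod (g x) \<le> 1) \<Longrightarrow> cmod (\<phi> (mult_op g)) \<le> D"
    show "cmod (?n \<phi>) \<le> D"
      using \<phi> atomic_proj_le[OF \<phi> D] by simp
  qed simp
  have "\<ominus>\<^bsub>bidual linf_alg\<^esub> ?z = (\<lambda>\<phi>\<in>linf_dual. - ?z \<phi>)"
    unfolding a_inv_def m_inv_def
  proof (rule the_equality)
    show "(\<lambda>\<phi>\<in>linf_dual. - ?z \<phi>) \<in> carrier (add_monoid (bidual linf_alg)) \<and>
      ?z \<otimes>\<^bsub>add_monoid (bidual linf_alg)\<^esub> (\<lambda>\<phi>\<in>linf_dual. - ?z \<phi>) = \<one>\<^bsub>add_monoid (bidual linf_alg)\<^esub> \<and>
      (\<lambda>\<phi>\<in>linf_dual. - ?z \<phi>) \<otimes>\<^bsub>add_monoid (bidual linf_alg)\<^esub> ?z = \<one>\<^bsub>add_monoid (bidual linf_alg)\<^esub>"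
      using neg by (auto intro!: restrict_ext)
  next
    fix Y :: "((('k \<Rightarrow> complex) \<Rightarrow> ('k \<Rightarrow> complex)) \<Rightarrow> complex) \<Rightarrow> complex"
    assume Y: "Y \<in> carrier (add_monoid (bidual linf_alg)) \<and>
      ?z \<otimes>\<^bsub>add_monoid (bidual linf_alg)\<^esub> Y = \<one>\<^bsub>add_monoid (bidual linf_alg)\<^esub> \<and>
      Y \<otimes>\<^bsub>add_monoid (bidual linf_alg)\<^esub> ?z = \<one>\<^bsub>add_monoid (bidual linf_alg)\<^esub>"
    show "Y = (\<lambda>\<phi>\<in>linf_dual. - ?z \<phi>)"
    proof (rule extensionalityI)
      show "Y \<in> extensional linf_dual"
        by (rule linf_bidual_extensional) (use Y in simp)
      fix \<phi> :: "(('k \<Rightarrow> complex) \<Rightarrow> ('k \<Rightarrow> complex)) \<Rightarrow> complex" assume \<phi>: "\<phi> \<in> linf_dual"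
      have "(\<lambda>\<phi>\<in>linf_dual. ?z \<phi> + Y \<phi>) \<phi> = (\<lambda>\<phi>\<in>linf_dual. 0) \<phi>" using Y by simp
      then show "Y \<phi> = (\<lambda>\<phi>\<in>linf_dual. - ?z \<phi>) \<phi>"
        using \<phi> by (simp add: eq_neg_iff_add_eq_0 add.commute)
    qed simp
  qed
  then show ?thesis
    by (auto simp: singular_part_proj_def normal_part_proj_linf a_minus_def evaluation_def intro!: restrict_ext)
qed

lemma linf_alg_pow:
  assumes "bounded (range g)"
  shows "mult_op g [^]\<^bsub>linf_alg\<^esub> (n::nat) = mult_op (\<lambda>x. g x ^ n)"
proof (induction n)
  case (Suc n)
  then show ?case using assms by (simp add: mult.commute)
qed simp

text \<open>For the evaluation at \<open>x\<close> shifted by \<open>g\<close>, the value at the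
  unit and the sum over the atoms are both \<open>g x\<close>, so their difference vanishes. This
  expresses that point evaluations are normal.\<close>

lemma translate_point_eval_singular:
  fixes x :: 'k
  shows "translate linf_alg (point_eval x) (singular_part_proj ell2 linf) = (\<lambda>T\<in>linf. 0)"
proof (rule extensionalityI[OF translate_extensional])
  fix T :: "('k \<Rightarrow> complex) \<Rightarrow> ('k \<Rightarrow> complex)" assume T: "T \<in> linf"
  then obtain g where g: "bounded (range g)" "T = mult_op g" by (rule linfE)
  have "(\<Sum>\<^sub>\<infinity>y. point y x * g x) = (\<Sum>\<^sub>\<infinity>y. point x y * g x)"
    by (intro infsum_cong) (simp add: point_def)
  also have "\<dots> = g x" by (rule infsum_point_mult)
  finally show "translate linf_alg (point_eval x) (singular_part_proj ell2 linf) T = (\<lambda>T\<in>linf. 0) T"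
    using g T by (simp add: translate_apply point_eval_closed singular_part_proj_linf dshift_closed
        dshift_apply atomic_proj_apply point_eval_apply)
qed simp

section \<open>The state of a countably complete ultrafilter\<close>

text \<open>Largeness is a predicate on sets of the whole type because \<open>'k\<close> is the
  index set of \<open>ell2\<close>. Freeness is expressed by singletons not being large, the form in
  which the state is seen to vanish on atoms.\<close>

locale countably_complete_ultrafilter =
  fixes large :: "'k set \<Rightarrow> bool"
  assumes not_large_empty: "\<not> large {}"
    and large_mono: "large A \<Longrightarrow> A \<subseteq> B \<Longrightarrow> large B"
    and large_INT: "(\<And>n::nat. large (F n)) \<Longrightarrow> large (\<Inter>n. F n)"
    and large_cases: "large A \<or> large (- A)"
    and not_large_singleton: "\<not> large {x}"
begin

lemma large_Int: "large A \<Longrightarrow> large B \<Longrightarrow> large (A \<inter> B)"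
proof -
  assume "large A" "large B"
  then have "large (\<Inter>n::nat. if n = 0 then A else B)" by (intro large_INT) auto
  then show ?thesis by (rule large_mono) (auto split: if_splits)
qed

lemma largeE:
  assumes "large A"
  obtains x where "x \<in> A"
  using assms not_large_empty by (cases "A = {}") auto

text \<open>A function into a second countable space is constant on a large set: intersect, over a
  countable basis, whichever of the preimage and its complement is large.\<close>

lemma large_constant:
  fixes g :: "'k \<Rightarrow> complex"
  obtains c where "large {x. g x = c}"
proof -
  obtain \<B> :: "complex set set" where \<B>: "countable \<B>" "topological_basis \<B>"
    using ex_countable_basis by blast
  have "\<B> \<noteq> {}"
    using topological_basisE[OF \<B>(2) open_UNIV UNIV_I] by blast
  define b where "b = from_nat_into \<B>"
  have b: "range b = \<B>" unfolding b_def by (rule range_from_nat_into[OF \<open>\<B> \<noteq> {}\<close> \<B>(1)])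
  define A where "A n = (if large (g -` b n) then g -` b n else - (g -` b n))" for n
  have "large (A n)" for n unfolding A_def using large_cases[of "g -` b n"] by auto
  then have "large (\<Inter>n. A n)" by (rule large_INT)
  then obtain x where x: "x \<in> (\<Inter>n. A n)" by (rule largeE)
  have "g y = g x" if y: "y \<in> (\<Inter>n. A n)" for y
  proof (rule ccontr)
    assume "g y \<noteq> g x"
    then obtain U where U: "open U" "g y \<in> U" "g x \<notin> U" using t1_space by blast
    then obtain B where B: "B \<in> \<B>" "g y \<in> B" "B \<subseteq> U" using topological_basisE[OF \<B>(2) U(1,2)] by blast
    then obtain n where "B = b n" using b by blast
    moreover have "x \<in> A n" "y \<in> A n" using x y by auto
    ultimately show False using B U by (auto simp: A_def split: if_splits)
  qed
  then have "(\<Inter>n. A n) \<subseteq> {y. g y = g x}" by blast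
  then show thesis using \<open>large (\<Inter>n. A n)\<close> large_mono that by blast
qed

text \<open>The limit along the ultrafilter, encoded as the value taken on a large set. By
  \<open>large_constant\<close> it exists for every function, bounded or not.\<close>

definition ulim :: "('k \<Rightarrow> complex) \<Rightarrow> complex" where
  "ulim g = (THE c. large {x. g x = c})"

lemma ulim_eqI:
  assumes "large {x. g x = c}"
  shows "ulim g = c"
  unfolding ulim_def
proof (rule the_equality)
  show "large {x. g x = c}" by (rule assms)
  fix d assume "large {x. g x = d}"
  then have "large ({x. g x = d} \<inter> {x. g x = c})" using assms by (rule large_Int)
  then show "d = c" by (rule largeE) auto
qed

lemma large_ulim: "large {x. g x = ulim g}"
  using large_constant[of g] ulim_eqI[of g] by metis

lemma ulim_add: "ulim (\<lambda>x. g x + h x) = ulim g + ulim h"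
  by (rule ulim_eqI, rule large_mono[OF large_Int[OF large_ulim[of g] large_ulim[of h]]]) auto

text \<open>\<open>f\<close> is arbitrary, with no continuity, since \<open>g\<close> is constant on
  a large set. The instances are constants, scalar multiples, squared moduli and powers.\<close>

lemma ulim_compose: "ulim (\<lambda>x. f (g x)) = f (ulim g)"
  by (rule ulim_eqI, rule large_mono[OF large_ulim[of g]]) auto

lemma ulim_point: "ulim (point x) = 0"
proof (rule ulim_eqI)
  have "large (- {x})" using large_cases[of "{x}"] not_large_singleton by blast
  then show "large {y. point x y = 0}" by (rule large_mono) (auto simp: point_def)
qed

text \<open>A large set is nonempty. This bounds the state by the supremum norm and supplies the
  point of the final contradiction.\<close>

lemma ulim_attained: obtains x where "g x = ulim g"
  using large_ulim[of g] by (rule largeE) auto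

definition ultra_state :: "(('k \<Rightarrow> complex) \<Rightarrow> ('k \<Rightarrow> complex)) \<Rightarrow> complex" where
  "ultra_state = (\<lambda>T\<in>linf. ulim (symbol T))"

lemma ultra_state_apply: "bounded (range g) \<Longrightarrow> ultra_state (mult_op g) = ulim g"
  by (simp add: ultra_state_def)

lemma ultra_state_closed: "ultra_state \<in> linf_dual"
  unfolding ultra_state_def
proof (rule linf_dualI[where C = 1])
  show "cmod (ulim g) \<le> 1 * K" if "\<And>x. cmod (g x) \<le> K" for g K
    using ulim_attained[of g] that by (metis mult_1)
qed (simp_all add: ulim_add ulim_compose[of "(*) _"])

lemma state_ultra_state: "state linf_alg ultra_state"
  unfolding state_def
proof (intro conjI ballI)
  show "ultra_state \<in> carrier (dual linf_alg)" by (simp add: ultra_state_closed)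
  fix T :: "('k \<Rightarrow> complex) \<Rightarrow> ('k \<Rightarrow> complex)" assume "T \<in> carrier linf_alg"
  then have "T \<in> linf" by simp
  then obtain g where g: "bounded (range g)" "T = mult_op g" by (rule linfE)
  have "ultra_state (star linf_alg T \<otimes>\<^bsub>linf_alg\<^esub> T) = ulim (\<lambda>x. cnj (g x) * g x)"
    using g by (simp add: ultra_state_apply)
  also have "\<dots> = cnj (ulim g) * ulim g"
    by (rule ulim_compose)
  also have "\<dots> = complex_of_real ((cmod (ulim g))\<^sup>2)"
    by (simp only: complex_norm_square mult.commute)
  also have "\<dots> \<in> \<real>\<^sub>\<ge>\<^sub>0" by simp
  finally show "ultra_state (star linf_alg T \<otimes>\<^bsub>linf_alg\<^esub> T) \<in> \<real>\<^sub>\<ge>\<^sub>0" .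
next
  \<comment> \<open>The outer function of \<open>ulim_compose\<close> is taken constant.\<close>
  have one: "ulim (\<lambda>x. 1) = 1" by (rule ulim_compose)
  show "vnorm (dual linf_alg) ultra_state = 1"
  proof (rule antisym)
    show "vnorm (dual linf_alg) ultra_state \<le> 1"
    proof (rule linf_dual_vnorm_le)
      fix g :: "'k \<Rightarrow> complex" assume g: "\<And>x. cmod (g x) \<le> 1"
      then have "bounded (range g)" using bounded_range_iff by blast
      moreover obtain x where "g x = ulim g" by (rule ulim_attained)
      ultimately show "cmod (ultra_state (mult_op g)) \<le> 1"
        using g[of x] by (simp add: ultra_state_apply)
    qed
    show "1 \<le> vnorm (dual linf_alg) ultra_state"
      using linf_dual_le_vnorm[OF ultra_state_closed, of "\<lambda>x. 1"] by (simp add: ultra_state_apply one del: dual_simps)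
  qed
qed

text \<open>Every shift of the state still vanishes on the atoms, as no singleton is large. The
  atomic part is therefore zero and the singular part projection acts as the identity.\<close>

lemma singular_ultra_state: "singular_functional ell2 linf ultra_state"
  unfolding singular_functional_def
proof (intro conjI linf_dual_eqI[OF ultra_state_closed])
  have s_apply: "singular_part_proj ell2 linf (dshift ultra_state g) = ulim g"
    if g: "bounded (range g)" for g :: "'k \<Rightarrow> complex"
  proof -
    have "dshift ultra_state g (mult_op (point x)) = 0" for x
    proof -
      have "(\<lambda>y. point x y * g y) = (\<lambda>y. g x * point x y)" by (auto simp: point_def)
      then show ?thesis
        using g ulim_compose[of "(*) (g x)" "point x"]
        by (simp add: dshift_apply ultra_state_apply ulim_point)
    qed
    then show ?thesis
      using g dshift_closed[OF ultra_state_closed g]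
      by (simp add: singular_part_proj_linf atomic_proj_apply dshift_apply ultra_state_apply)
  qed
  show "ultra_state \<in> carrier (dual linf_alg)" by (simp add: ultra_state_closed)
  show eq: "ultra_state (mult_op g) = translate linf_alg ultra_state (singular_part_proj ell2 linf) (mult_op g)"
    if "bounded (range g)" for g
    using that by (simp add: translate_apply ultra_state_closed s_apply ultra_state_apply)
  \<comment> \<open>Boundedness of the translate is read off from its equality with the state, so
    membership of the singular part projection in the bidual does not have to be
    established.\<close>
  have "translate linf_alg ultra_state (singular_part_proj ell2 linf) = ultra_state"
  proof (rule extensionalityI[OF translate_extensional linf_dual_extensional[OF ultra_state_closed]])
    fix T :: "('k \<Rightarrow> complex) \<Rightarrow> ('k \<Rightarrow> complex)" assume "T \<in> linf"
    then obtain g where g: "bounded (range g)" "T = mult_op g" by (rule linfE)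
    then show "translate linf_alg ultra_state (singular_part_proj ell2 linf) T = ultra_state T"
      using eq by simp
  qed
  then show "translate linf_alg ultra_state (singular_part_proj ell2 linf) \<in> linf_dual"
    using ultra_state_closed by simp
qed

lemma not_ueda_peak_set_property: "\<not> ueda_peak_set_property ell2 (linf :: (('k \<Rightarrow> complex) \<Rightarrow> ('k \<Rightarrow> complex)) set)"
proof
  assume "ueda_peak_set_property ell2 (linf :: (('k \<Rightarrow> complex) \<Rightarrow> ('k \<Rightarrow> complex)) set)"
  then obtain q where peak: "peak_projection linf_alg q" and q1: "q ultra_state = 1"
    and le: "proj_le (bidual linf_alg) q (singular_part_proj ell2 linf)"
    unfolding ueda_peak_set_property_def using state_ultra_state singular_ultra_state by blast
  obtain a where "a \<in> linf" and lim: "\<And>\<phi>. \<phi> \<in> linf_dual \<Longrightarrow>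
      (\<lambda>n::nat. evaluation linf_alg (a [^]\<^bsub>linf_alg\<^esub> n) \<phi>) \<longlonglongrightarrow> q \<phi>"
    using peak unfolding peak_projection_def by auto
  then obtain g where g: "bounded (range g)" "a = mult_op g" using linfE by blast
  obtain x where x: "g x = ulim g" by (rule ulim_attained)
  have bd: "bounded (range (\<lambda>y. g y ^ n))" for n
    by (induction n) (use g(1) in simp_all)
  have "(\<lambda>n. ulim g ^ n) \<longlonglongrightarrow> q ultra_state"
    using lim[OF ultra_state_closed] ultra_state_closed
    by (simp add: evaluation_def g(2) linf_alg_pow[OF g(1)] ultra_state_apply[OF bd] ulim_compose[of "\<lambda>c. c ^ _"])
  moreover have "(\<lambda>n. ulim g ^ n) \<longlonglongrightarrow> q (point_eval x)"
    using lim[OF point_eval_closed[of x]] point_eval_closed[of x]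
    by (simp add: evaluation_def g(2) linf_alg_pow[OF g(1)] point_eval_apply[OF bd] x)
  ultimately have "q (point_eval x) = 1"
    using LIMSEQ_unique q1 by metis
  have q: "q \<in> linf_bidual" "q \<otimes>\<^bsub>bidual linf_alg\<^esub> singular_part_proj ell2 linf = q"
    using le by (auto simp: proj_le_def projection_def)
  \<comment> \<open>Domination means that \<open>q\<close> absorbs the singular part projection, and
    that projection annihilates the evaluation at \<open>x\<close>.\<close>
  have "q (point_eval x) = (q \<otimes>\<^bsub>bidual linf_alg\<^esub> singular_part_proj ell2 linf) (point_eval x)"
    by (simp only: q(2))
  also have "\<dots> = q (\<lambda>T\<in>linf. 0)"
    by (simp add: bidual_mult_apply point_eval_closed translate_point_eval_singular)
  \<comment> \<open>The zero functional is written as a scalar multiple of a known element of the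
    dual so that homogeneity of \<open>q\<close> applies.\<close>
  also have "\<dots> = q (\<lambda>T\<in>linf. 0 * point_eval x T)" by simp
  also have "\<dots> = 0" using linf_bidual_smult[OF q(1) point_eval_closed, of 0 x] by simp
  finally show False using \<open>q (point_eval x) = 1\<close> by simp
qed

end

section \<open>From a measurable cardinal to an ultrafilter on the whole type\<close>

lemma measurable_cardinal_countably_complete_ultrafilter:
  fixes \<kappa> :: "'k rel"
  assumes "measurable_cardinal \<kappa>"
  obtains large :: "'k set \<Rightarrow> bool" where "countably_complete_ultrafilter large"
proof -
  obtain U where \<kappa>: "Card_order \<kappa>" "natLeq <o \<kappa>" and U: "complete_ultrafilter \<kappa> U"
    and np: "nonprincipal_on (Field \<kappa>) U"
    using assms unfolding measurable_cardinal_def by blast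
  let ?K = "Field \<kappa>"
  have uf: "ultrafilter_on ?K U" using U by (simp add: complete_ultrafilter_def)
  have sub: "A \<subseteq> ?K" if "A \<in> U" for A using uf that unfolding ultrafilter_on_def by blast
  have up: "B \<in> U" if "A \<in> U" "A \<subseteq> B" "B \<subseteq> ?K" for A B
    using uf that unfolding ultrafilter_on_def by blast
  \<comment> \<open>\<open>Field \<kappa>\<close> may be a proper subset of the type; sets are large according to their trace on it.\<close>
  have "countably_complete_ultrafilter (\<lambda>A. A \<inter> ?K \<in> U)"
  proof
    show "\<not> {} \<inter> ?K \<in> U" using uf by (simp add: ultrafilter_on_def)
    show "B \<inter> ?K \<in> U" if "A \<inter> ?K \<in> U" "A \<subseteq> B" for A B by (rule up[OF that(1)]) (use that in auto)
    show "A \<inter> ?K \<in> U \<or> - A \<inter> ?K \<in> U" for A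
    proof -
      have "A \<inter> ?K \<in> U \<or> ?K - A \<inter> ?K \<in> U" using uf unfolding ultrafilter_on_def by blast
      moreover have "?K - A \<inter> ?K = - A \<inter> ?K" by auto
      ultimately show ?thesis by simp
    qed
    show "\<not> {x} \<inter> ?K \<in> U" for x
    proof
      \<comment> \<open>A singleton in the ultrafilter meets each of its members, which makes the
        ultrafilter principal at that point.\<close>
      assume x: "{x} \<inter> ?K \<in> U"
      then have xK: "x \<in> ?K" using uf unfolding ultrafilter_on_def by (cases "x \<in> ?K") auto
      then have xU: "{x} \<in> U" using x by simp
      have "x \<in> A" if "A \<in> U" for A
      proof -
        have "A \<inter> {x} \<in> U" "{} \<notin> U" using that xU uf unfolding ultrafilter_on_def by blast+
        then show ?thesis by (cases "x \<in> A") auto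
      qed
      then have "U = {A. A \<subseteq> ?K \<and> x \<in> A}"
        using sub up[OF xU] by blast
      then show False using np xK unfolding nonprincipal_on_def by blast
    qed
    show "(\<Inter>n. A n) \<inter> ?K \<in> U" if A: "\<And>n::nat. A n \<inter> ?K \<in> U" for A
    proof -
      let ?S = "range (\<lambda>n. A n \<inter> ?K)"
      have "|?S| \<le>o |UNIV :: nat set|" by (rule card_of_image)
      also have "|UNIV :: nat set| =o natLeq" by (rule card_of_nat)
      \<comment> \<open>Uncountability of \<open>\<kappa>\<close> enters here: a countable family is
        small enough for \<open>\<kappa>\<close>-completeness.\<close>
      finally have "|?S| <o \<kappa>" using \<kappa>(2) by (rule ordLeq_ordLess_trans)
      moreover have "?S \<subseteq> U" "?S \<noteq> {}" using A by blast+
      ultimately have "\<Inter>?S \<in> U"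
        using U[unfolded complete_ultrafilter_def, THEN conjunct2, THEN spec, of ?S] by (simp only: simp_thms)
      moreover have "\<Inter>?S = (\<Inter>n. A n) \<inter> ?K" by auto
      ultimately show ?thesis by simp
    qed
  qed
  then show thesis by (rule that)
qed

text \<open>The hypothesis is applied to \<open>ell2\<close> over the type \<open>'k\<close> that
  carries \<open>\<kappa>\<close>. Its vectors are functions from \<open>'k\<close> to the complex
  numbers, which explains the type over which the Hilbert spaces range.\<close>

theorem theorem6p1:
  assumes "\<forall>(H :: ('k \<Rightarrow> complex) hspace) M.
             von_neumann_algebra H M \<and> finite_algebra (vn_alg H M) \<longrightarrow> ueda_peak_set_property H M"
  shows "\<not> (\<exists>\<kappa> :: 'k rel. measurable_cardinal \<kappa>)"
proof
  assume "\<exists>\<kappa> :: 'k rel. measurable_cardinal \<kappa>"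
  then obtain \<kappa> :: "'k rel" where "measurable_cardinal \<kappa>" by blast
  then obtain large :: "'k set \<Rightarrow> bool" where "countably_complete_ultrafilter large"
    by (rule measurable_cardinal_countably_complete_ultrafilter)
  then have "\<not> ueda_peak_set_property ell2 (linf :: (('k \<Rightarrow> complex) \<Rightarrow> ('k \<Rightarrow> complex)) set)"
    by (rule countably_complete_ultrafilter.not_ueda_peak_set_property)
  then show False
    using assms von_neumann_algebra_linf finite_algebra_linf by blast
qed

end
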